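(* Let $w\in S_n$ and $D_1,D_2\in\mathrm{RPD}(w)$. Then the join $D_1\vee D_2$ exists in the poset $(\mathrm{RPD}(w),\le)$ and is given by the output of the following recursive algorithm: (i) If $D_1=D_2$, return $D_1$. (ii) If $D_1\neq D_2$, let $(i,j)$ be the principal disagreement between $D_1$ and $D_2$. If $D_1(i,j)=+$ and $D_2(i,j)=\bullet$, return the output of the algorithm on the pair $(\mathcal{M}_{ij}(D_1),D_2)$. Otherwise, return the output of the algorithm on the pair $(D_1,\mathcal{M}_{ij}(D_2))$.
   Context: A pipe dream is a finite subset $D\subset \mathbb{Z}_{>0}\times\mathbb{Z}_{>0}$, in matrix coordinates ($(i,j)$ is row $i$ from the top, column $j$ from the left). Place a cross tile at each $(i,j)\in D$ (one strand joins the left and right edges, the other joins the top and bottom edges) and a bump tile at each $(i,j)\notin D$ (one strand joins the top edge to the left edge, the other joins the right edge to the bottom edge). Write $D(i,j)=+$ if $(i,j)\in D$ and $D(i,j)=\bullet$ otherwise. The strands form pipes going from the top boundary to the left boundary; pipe $x$ is the one entering at the top of column $x$. The permutation $w$ of $D$ is defined by: $w(i)$ is the label of the pipe that exits the left boundary in row $i$. Permutations $w\in S_n$ are regarded as permutations of $\mathbb{Z}_{>0}$ fixing all $m>n$. $\mathrm{RPD}(w)$ is the set of reduced pipe dreams for $w$: pipe dreams $D$ whose permutation is $w$ and such that $|D|$ equals the number of inversions of $w$. Generalized ladder move: let $D\in\mathrm{RPD}(w)$, and suppose there are $h<i$ and $j<k$ such that $D(i,j)=+$, $D(h,j)=D(i,k)=D(h,k)=\bullet$,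 and every other tile in $[h,i]\times[j,k]$ is a $+$. Then $(i,j)$ is called ladder movable in $D$, and $\mathcal{L}_{ij}(D)\in\mathrm{RPD}(w)$ is obtained from $D$ by swapping the tiles at $(i,j)$ and $(h,k)$ (given $(i,j)$, the pair $(h,k)$ is unique). Order: $D\le D'$ in $\mathrm{RPD}(w)$ iff $D'$ can be obtained from $D$ by a (possibly empty) sequence of generalized ladder moves. Move operators: a cross tile $(i,j)$ of $D$ is movable in $D$ if $D(h,j)=\bullet$ for some $h\in[1,i-1]$. Then put $h_{ij}(D)=\max\{h\in[1,i-1]: D(h,j)=\bullet\}$, $k_{ij}(D)=\min\{k\in[j+1,n]: D(i,k)=\bullet\}$ (which exists), $\mathrm{Rect}_{ij}(D)=[h,i]\times[j,k]$ with $h=h_{ij}(D)$, $k=k_{ij}(D)$, let $a$ be the largest $p\in[h,i)$ such that row $p$ contains a $\bullet$ in $\mathrm{Rect}_{ij}(D)$, and let $b$ be the smallest $q\in(j,k]$ such that column $q$ contains a $\bullet$ in $\mathrm{Rect}_{ij}(D)$. Define $\mathcal{M}_{ij}(D)$ recursively for $(i,j)$ movable in $D$: (i) if $a=h$ and $b=k$, then $(i,j)$ is ladder movable and $\mathcal{M}_{ij}(D)=\mathcal{L}_{ij}(D)$; (ii) if $a>h$, $\mathcal{M}_{ij}(D)=\mathcal{M}_{ij}(\mathcal{M}_{aj}(D))$; (iii) otherwise, $\mathcal{M}_{ij}(D)=\mathcal{M}_{ij}(\mathcal{M}_{ib}(D))$. This recursion is well defined and terminates. Principal disagreement: let $\prec$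 be the total order on $[n]\times[n]$ with $(i,j)\prec(i',j')$ iff $i>i'$, or $i=i'$ and $j<j'$. For $D_1\ne D_2$ in $\mathrm{RPD}(w)$, the principal disagreement is the $\prec$-minimal $(i,j)$ with $D_1(i,j)\neq D_2(i,j)$. *)

theory Defs
  imports "HOL-Combinatorics.Permutations" "HOL-Algebra.Lattice"
begin

section \<open>Pipe dreams and their permutations\<close>

text \<open>A pipe dream is identified with its set of cross tiles, in matrix coordinates starting at 1.\<close>

type_synonym pipe_dream = "(nat \<times> nat) set"

definition pipe_dream :: "pipe_dream \<Rightarrow> bool" where
  "pipe_dream D \<longleftrightarrow> finite D \<and> D \<subseteq> {1..} \<times> {1..}"

text \<open>
  The edges of the grid: \<open>H i j\<close> is the bottom edge and \<open>V i j\<close> the right edge of tile \<open>(i, j)\<close>.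
  So \<open>H 0 j\<close> is the top boundary in column \<open>j\<close>, \<open>V i 0\<close> is the left boundary in row \<open>i\<close>, and
  the top and left edges of \<open>(Suc i, Suc j)\<close> are \<open>H i (Suc j)\<close> and \<open>V (Suc i) j\<close>.
\<close>

datatype edge = H nat nat | V nat nat

text \<open>
  \<open>on_pipe D x e\<close>: pipe \<open>x\<close> of \<open>D\<close> passes through edge \<open>e\<close>. Pipes are followed from the top
  boundary towards the left boundary, so every tile is entered through its top or right edge.
\<close>

inductive on_pipe :: "pipe_dream \<Rightarrow> nat \<Rightarrow> edge \<Rightarrow> bool" for D :: pipe_dream and x :: nat where
  start: "0 < x \<Longrightarrow> on_pipe D x (H 0 x)"
| cross_down: "on_pipe D x (H i (Suc j)) \<Longrightarrow> (Suc i, Suc j) \<in> D \<Longrightarrow> on_pipe D x (H (Suc i) (Suc j))"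
| cross_left: "on_pipe D x (V (Suc i) (Suc j)) \<Longrightarrow> (Suc i, Suc j) \<in> D \<Longrightarrow> on_pipe D x (V (Suc i) j)"
| bump_left: "on_pipe D x (H i (Suc j)) \<Longrightarrow> (Suc i, Suc j) \<notin> D \<Longrightarrow> on_pipe D x (V (Suc i) j)"
| bump_down: "on_pipe D x (V (Suc i) (Suc j)) \<Longrightarrow> (Suc i, Suc j) \<notin> D \<Longrightarrow> on_pipe D x (H (Suc i) (Suc j))"

definition has_permutation :: "pipe_dream \<Rightarrow> (nat \<Rightarrow> nat) \<Rightarrow> bool" where
  "has_permutation D w \<longleftrightarrow> (\<forall>i>0. on_pipe D (w i) (V i 0))"

definition inversions :: "(nat \<Rightarrow> nat) \<Rightarrow> (nat \<times> nat) set" where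
  "inversions w = {(i, j). 0 < i \<and> i < j \<and> w j < w i}"

definition RPD :: "(nat \<Rightarrow> nat) \<Rightarrow> pipe_dream set" where
  "RPD w = {D. pipe_dream D \<and> has_permutation D w \<and> card D = card (inversions w)}"


section \<open>Generalized ladder moves and the poset of reduced pipe dreams\<close>

definition ladder_corner :: "pipe_dream \<Rightarrow> nat \<Rightarrow> nat \<Rightarrow> nat \<Rightarrow> nat \<Rightarrow> bool" where
  "ladder_corner D i j h k \<longleftrightarrow>
     1 \<le> h \<and> h < i \<and> 1 \<le> j \<and> j < k \<and>
     (i, j) \<in> D \<and> (h, j) \<notin> D \<and> (i, k) \<notin> D \<and> (h, k) \<notin> D \<and>
     (\<forall>p\<in>{h..i}. \<forall>q\<in>{j..k}. (p, q) \<notin> {(h, j), (i, k), (h, k)} \<longrightarrow> (p, q) \<in> D)"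

definition ladder_movable :: "pipe_dream \<Rightarrow> nat \<Rightarrow> nat \<Rightarrow> bool" where
  "ladder_movable D i j \<longleftrightarrow> (\<exists>h k. ladder_corner D i j h k)"

definition ladder_move :: "pipe_dream \<Rightarrow> nat \<Rightarrow> nat \<Rightarrow> pipe_dream" where
  "ladder_move D i j =
     (let c = (THE (h, k). ladder_corner D i j h k) in insert c (D - {(i, j)}))"

definition ladder_step :: "pipe_dream \<Rightarrow> pipe_dream \<Rightarrow> bool" where
  "ladder_step D D' \<longleftrightarrow> (\<exists>i j. ladder_movable D i j \<and> D' = ladder_move D i j)"

definition RPD_poset :: "(nat \<Rightarrow> nat) \<Rightarrow> pipe_dream gorder" where
  "RPD_poset w = \<lparr>carrier = RPD w, eq = (=), le = ladder_step\<^sup>*\<^sup>*\<rparr>"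

lemma ladder_corner_unique:
  assumes "ladder_corner D i j h k" "ladder_corner D i j h' k'"
  shows "h = h'" "k = k'"
proof -
  have "\<not> a < b" if ac: "ladder_corner D i j a c" and bd: "ladder_corner D i j b d" for a b c d
  proof
    assume "a < b"
    have bd': "b < i" "(b, j) \<notin> D" using bd by (simp_all add: ladder_corner_def)
    have ac': "j < c" "\<And>p q. p \<in> {a..i} \<Longrightarrow> q \<in> {j..c} \<Longrightarrow>
        (p, q) \<notin> {(a, j), (i, c), (a, c)} \<Longrightarrow> (p, q) \<in> D"
      using ac by (simp_all add: ladder_corner_def)
    show False using ac'(2)[of b j] ac'(1) bd' \<open>a < b\<close> by simp
  qed
  with assms show "h = h'" by (meson linorder_neqE_nat)
  have "\<not> c < d" if ac: "ladder_corner D i j a c" and bd: "ladder_corner D i j b d" for a b c d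
  proof
    assume "c < d"
    have ac': "j < c" "(i, c) \<notin> D" using ac by (simp_all add: ladder_corner_def)
    have bd': "b < i" "\<And>p q. p \<in> {b..i} \<Longrightarrow> q \<in> {j..d} \<Longrightarrow>
        (p, q) \<notin> {(b, j), (i, d), (b, d)} \<Longrightarrow> (p, q) \<in> D"
      using bd by (simp_all add: ladder_corner_def)
    show False using bd'(2)[of i c] bd'(1) ac' \<open>c < d\<close> by simp
  qed
  with assms show "k = k'" by (meson linorder_neqE_nat)
qed

lemma ladder_move_eq:
  assumes "ladder_corner D i j h k"
  shows "ladder_move D i j = insert (h, k) (D - {(i, j)})"
proof -
  have "(THE (h, k). ladder_corner D i j h k) = (h, k)"
  proof (rule the_equality)
    show "case (h, k) of (h, k) \<Rightarrow> ladder_corner D i j h k" using assms by simp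
    show "c = (h, k)" if "case c of (h, k) \<Rightarrow> ladder_corner D i j h k" for c
      using that ladder_corner_unique[OF _ assms] by (cases c) simp
  qed
  then show ?thesis by (simp add: ladder_move_def)
qed

lemma ladder_step_sum_less:
  assumes "ladder_step D D'" "finite D"
  shows "finite D'" "sum fst D' < sum fst D"
proof -
  from assms(1) obtain i j h k
    where c: "ladder_corner D i j h k" and D': "D' = insert (h, k) (D - {(i, j)})"
    by (auto simp: ladder_step_def ladder_movable_def ladder_move_eq)
  from c have h: "h < i" "(h, k) \<notin> D" "(i, j) \<in> D" by (auto simp: ladder_corner_def)
  show "finite D'" using assms(2) D' by simp
  have "sum fst D = i + sum fst (D - {(i, j)})"
    using sum.remove[OF assms(2) h(3), of fst] by simp
  moreover have "sum fst D' = h + sum fst (D - {(i, j)})"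
    using assms(2) h unfolding D' by (subst sum.insert) auto
  ultimately show "sum fst D' < sum fst D" using h(1) by simp
qed

lemma ladder_steps_sum_le:
  assumes "ladder_step\<^sup>*\<^sup>* D D'" "finite D"
  shows "finite D' \<and> (D' = D \<or> sum fst D' < sum fst D)"
  using assms
proof (induction rule: rtranclp_induct)
  case (step E F)
  then show ?case using ladder_step_sum_less[of E F] by auto
qed simp

text \<open>By antisymmetry, joins are unique when they exist.\<close>

lemma RPD_poset_partial_order: "partial_order (RPD_poset w)"
proof
  fix D D'
  assume *: "D \<sqsubseteq>\<^bsub>RPD_poset w\<^esub> D'" "D' \<sqsubseteq>\<^bsub>RPD_poset w\<^esub> D"
    "D \<in> carrier (RPD_poset w)" "D' \<in> carrier (RPD_poset w)"
  then have "finite D" "finite D'" "ladder_step\<^sup>*\<^sup>* D D'" "ladder_step\<^sup>*\<^sup>* D' D"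
    by (auto simp: RPD_poset_def RPD_def pipe_dream_def)
  then have "D' = D \<or> sum fst D' < sum fst D" "D = D' \<or> sum fst D < sum fst D'"
    using ladder_steps_sum_le by blast+
  then have "D = D'" by (metis less_asym)
  then show "D .=\<^bsub>RPD_poset w\<^esub> D'" by (simp add: RPD_poset_def)
qed (simp_all add: RPD_poset_def)


section \<open>Move operators\<close>

definition movable :: "pipe_dream \<Rightarrow> nat \<Rightarrow> nat \<Rightarrow> bool" where
  "movable D i j \<longleftrightarrow> (i, j) \<in> D \<and> (\<exists>h\<in>{1..<i}. (h, j) \<notin> D)"

definition rect_h :: "pipe_dream \<Rightarrow> nat \<Rightarrow> nat \<Rightarrow> nat" where
  "rect_h D i j = Max {h \<in> {1..<i}. (h, j) \<notin> D}"

definition rect_k :: "nat \<Rightarrow> pipe_dream \<Rightarrow> nat \<Rightarrow> nat \<Rightarrow> nat" where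
  "rect_k n D i j = Min {k \<in> {j+1..n}. (i, k) \<notin> D}"

definition Rect :: "nat \<Rightarrow> pipe_dream \<Rightarrow> nat \<Rightarrow> nat \<Rightarrow> (nat \<times> nat) set" where
  "Rect n D i j = {rect_h D i j..i} \<times> {j..rect_k n D i j}"

definition rect_a :: "nat \<Rightarrow> pipe_dream \<Rightarrow> nat \<Rightarrow> nat \<Rightarrow> nat" where
  "rect_a n D i j = Max {p \<in> {rect_h D i j..<i}. \<exists>q. (p, q) \<in> Rect n D i j \<and> (p, q) \<notin> D}"

definition rect_b :: "nat \<Rightarrow> pipe_dream \<Rightarrow> nat \<Rightarrow> nat \<Rightarrow> nat" where
  "rect_b n D i j = Min {q \<in> {j<..rect_k n D i j}. \<exists>p. (p, q) \<in> Rect n D i j \<and> (p, q) \<notin> D}"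

text \<open>
  \<open>Some D'\<close> is the result of a terminating run; \<open>None\<close> means that the recursion does not terminate
  or reaches a tile that cannot be moved.
\<close>

partial_function (option) move :: "nat \<Rightarrow> pipe_dream \<Rightarrow> nat \<Rightarrow> nat \<Rightarrow> pipe_dream option" where
  "move n D i j =
    (if \<not> movable D i j then None
     else if rect_a n D i j = rect_h D i j \<and> rect_b n D i j = rect_k n D i j then
       (if ladder_movable D i j then Some (ladder_move D i j) else None)
     else if rect_a n D i j > rect_h D i j then
       Option.bind (move n D (rect_a n D i j) j) (\<lambda>D'. move n D' i j)
     else
       Option.bind (move n D i (rect_b n D i j)) (\<lambda>D'. move n D' i j))"


section \<open>The join algorithm\<close>

definition prec :: "nat \<times> nat \<Rightarrow> nat \<times> nat \<Rightarrow> bool" (infix \<open>\<prec>\<close> 50) where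
  "p \<prec> q \<longleftrightarrow> fst p > fst q \<or> fst p = fst q \<and> snd p < snd q"

definition principal_disagreement :: "nat \<Rightarrow> pipe_dream \<Rightarrow> pipe_dream \<Rightarrow> nat \<times> nat" where
  "principal_disagreement n D\<^sub>1 D\<^sub>2 =
     (THE p. p \<in> {1..n} \<times> {1..n} \<and> (p \<in> D\<^sub>1 \<longleftrightarrow> p \<notin> D\<^sub>2) \<and>
        (\<forall>q \<in> {1..n} \<times> {1..n}. (q \<in> D\<^sub>1 \<longleftrightarrow> q \<notin> D\<^sub>2) \<longrightarrow> q = p \<or> p \<prec> q))"

partial_function (option) join_alg :: "nat \<Rightarrow> pipe_dream \<Rightarrow> pipe_dream \<Rightarrow> pipe_dream option" where
  "join_alg n D\<^sub>1 D\<^sub>2 =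
    (if D\<^sub>1 = D\<^sub>2 then Some D\<^sub>1
     else case principal_disagreement n D\<^sub>1 D\<^sub>2 of (i, j) \<Rightarrow>
       if (i, j) \<in> D\<^sub>1 \<and> (i, j) \<notin> D\<^sub>2 then
         Option.bind (move n D\<^sub>1 i j) (\<lambda>D\<^sub>1'. join_alg n D\<^sub>1' D\<^sub>2)
       else
         Option.bind (move n D\<^sub>2 i j) (\<lambda>D\<^sub>2'. join_alg n D\<^sub>1 D\<^sub>2'))"

end

theory Submission
  imports Defs
begin

text \<open>
  A ladder move takes a cross to the north-east, so a tile that is minimal towards the south-west
  among those where \<open>D \<le> U\<close> disagree is a cross of \<open>D\<close> and a bump of \<open>U\<close>. Let \<open>q\<close> be such a tile.
  Two facts of a diamond lemma type, proved by comparing pairs of ladder moves (which commute or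
  span a pentagon), carry the argument; neither needs the pipe dreams to be reduced.

  \<^item> Every single ladder move in the recursion for \<open>\<M>\<^sub>q(D)\<close> leads to an element that is still below
    \<open>U\<close>. Hence \<open>\<M>\<^sub>q(D) \<le> U\<close>.
  \<^item> \<open>U\<close> has a lower cover that depends on \<open>U\<close> and \<open>q\<close> only and lies above every \<open>D \<le> U\<close> for which \<open>q\<close>
    is a cross and a minimal disagreement.

  Let \<open>U\<close> be an upper bound of \<open>D\<^sub>1\<close> and \<open>D\<^sub>2\<close>, and let their principal disagreement \<open>p\<close> be a cross of
  \<open>D\<^sub>1\<close>. If \<open>U\<close> agrees with \<open>D\<^sub>1\<close> before \<open>p\<close>, the first fact gives \<open>\<M>\<^sub>p(D\<^sub>1) \<le> U\<close>; otherwise the second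
  one replaces \<open>U\<close> by a smaller upper bound. So each step of the algorithm preserves the set of upper
  bounds. Reducedness only enters to show that \<open>p\<close> is movable and that \<open>\<M>\<^sub>p\<close> never gets stuck.
\<close>

text \<open>The lower cover of the second fact is found by following \<open>link\<close>s of
  \<open>U\<close> from \<open>q\<close> to a bump without outgoing link. Such a bump is the lower
  left corner of an inverse ladder as soon as its column has a bump above it and its row a bump to
  its right. The bump above is not automatic: it comes from the existence of a chain up to
  \<open>U\<close> that starts with a cross at \<open>q\<close>. Therefore the existence of these
  bumps and the fact that the inverse moves at ends of link paths stay above \<open>D\<close> are
  proved in a single induction. The obstacle is that undoing the last move of a given chain may
  destroy the links that lead to the wanted inverse ladder. Then either a neighbouring bump takes
  over, or another chain with a different last move is used. The two sides of a pentagon have two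
  and three moves, so inductions run over the sum of the row numbers of the crosses and not over the
  length of chains. Chains are restricted by \<open>avoids\<close> instead of
  \<open>\<prec>\<close>, because this weaker condition is invariant under exchanging the
  coordinates, which halves the case analyses.\<close>

section \<open>Ladders\<close>

text \<open>
  A grid \<open>E\<close> is given by its crosses in Cartesian coordinates: \<open>E x y\<close> stands for the tile in column
  \<open>x\<close> and row \<open>-y\<close>. In this form the theory is symmetric under exchanging the coordinates, which
  reflects the plane in an antidiagonal.
\<close>

definition ladder_frame :: "(int \<Rightarrow> int \<Rightarrow> bool) \<Rightarrow> int \<Rightarrow> int \<Rightarrow> int \<Rightarrow> int \<Rightarrow> bool" where
  "ladder_frame E x y k h \<longleftrightarrow> x < k \<and> y < h \<and> \<not> E x h \<and> \<not> E k y \<and>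
     (\<forall>a b. x \<le> a \<and> a \<le> k \<and> y \<le> b \<and> b \<le> h \<and> \<not> ((a = x \<or> a = k) \<and> (b = y \<or> b = h)) \<longrightarrow> E a b)"

definition ladder where
  "ladder E x y k h \<longleftrightarrow> ladder_frame E x y k h \<and> E x y \<and> \<not> E k h"

definition inverse_ladder where
  "inverse_ladder E x y k h \<longleftrightarrow> ladder_frame E x y k h \<and> \<not> E x y \<and> E k h"

definition relocate :: "(int \<Rightarrow> int \<Rightarrow> bool) \<Rightarrow> int \<Rightarrow> int \<Rightarrow> int \<Rightarrow> int \<Rightarrow> int \<Rightarrow> int \<Rightarrow> bool" where
  "relocate E x y k h = (\<lambda>a b. a = k \<and> b = h \<or> E a b \<and> \<not> (a = x \<and> b = y))"

text \<open>Any chain of moves that turns the cross \<open>(qx, qy)\<close> into a bump ends above the result of moving this ladder.\<close>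

definition forced_ladder where
  "forced_ladder E qx qy x y k h \<longleftrightarrow> ladder E x y k h \<and> qx \<le> x \<and> qy \<le> y \<and>
     (\<forall>a b. qx \<le> a \<and> a < k \<and> qy \<le> b \<and> b < h \<longrightarrow> E a b)"

text \<open>
  The bump \<open>(x', y')\<close> has to be filled before a cross can be moved back into \<open>(x, y)\<close>. Nothing is
  required of the two remaining corners of the rectangle: with this choice links are hardly affected
  by inverse moves elsewhere.
\<close>

definition link where
  "link E x y x' y' \<longleftrightarrow> x < x' \<and> y < y' \<and> \<not> E x y \<and> \<not> E x' y' \<and>
     (\<forall>a b. x \<le> a \<and> a \<le> x' \<and> y \<le> b \<and> b \<le> y' \<and> \<not> ((a = x \<or> a = x') \<and> (b = y \<or> b = y')) \<longrightarrow> E a b)"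

lemmas tile_defs = ladder_frame_def ladder_def inverse_ladder_def relocate_def forced_ladder_def link_def

text \<open>The bump \<open>(k, h)\<close> is both the target of the first ladder and the upper left
  corner of the second, while the second takes the cross \<open>(k, y1)\<close> out of the right
  edge of the first. So the moves do not commute, but the two orders meet again after two and three
  moves.\<close>

lemma pentagon_right:
  assumes "ladder D x y k h" "ladder D k y1 k2 h" "y < y1"
  shows "ladder (relocate D x y k h) x y1 k2 h"
    "ladder (relocate D k y1 k2 h) x y1 k h"
    "ladder (relocate (relocate D k y1 k2 h) x y1 k h) x y k y1"
    "relocate (relocate D x y k h) x y1 k2 h = relocate (relocate (relocate D k y1 k2 h) x y1 k h) x y k y1"
proof -
  note A = assms[unfolded tile_defs]
  show "ladder (relocate D x y k h) x y1 k2 h" using A unfolding tile_defs by (smt (verit))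
  show "ladder (relocate D k y1 k2 h) x y1 k h" using A unfolding tile_defs by (smt (verit))
  show "ladder (relocate (relocate D k y1 k2 h) x y1 k h) x y k y1" using A unfolding tile_defs by (smt (verit))
  show "relocate (relocate D x y k h) x y1 k2 h = relocate (relocate (relocate D k y1 k2 h) x y1 k h) x y k y1"
    using A unfolding tile_defs by (intro ext) (smt (verit))
qed

text \<open>The bumps \<open>(x, h)\<close> and \<open>(k, y)\<close> confine the box of the link to
  the box of the inverse ladder, where no bump is left for its far end. So inverse ladders occur on
  link paths only at ends that cannot be continued.\<close>

lemma inverse_ladder_no_link:
  assumes "inverse_ladder U x y k h" "link U x y x' y'" shows False
  using assms unfolding tile_defs by (smt (verit))

lemma inverse_ladder_unique:
  assumes "inverse_ladder U x y k h" "inverse_ladder U x y k' h'" shows "k' = k \<and> h' = h"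
  using assms unfolding tile_defs by (smt (verit))

text \<open>Undoing a move breaks a link only by filling its far end or by taking a cross from the
  left or the bottom edge of its box; in the last two cases the near end is the lower right or the
  upper left corner of the frame of the move.\<close>

lemma link_inverse_ladder_cases:
  assumes "link U x y x' y'" "inverse_ladder U rx ry mx my"
  shows "link (relocate U mx my rx ry) x y x' y' \<or> rx = x' \<and> ry = y' \<or>
     mx = x \<and> ry = y \<and> rx < x \<and> y < my \<and> my < y' \<or>
     my = y \<and> rx = x \<and> ry < y \<and> x < mx \<and> mx < x'"
  using assms unfolding tile_defs by (smt (verit))

text \<open>The frame bumps of the other ladder lie outside the crosses between \<open>q\<close> and
  \<open>(k, h)\<close>. Hence its box contains the bump \<open>(k, h)\<close>, which must be its
  own upper right corner, and then the two frames coincide.\<close>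

lemma forced_ladder_other_cross:
  assumes "forced_ladder D qx qy x y k h" "ladder D px py mx my" "\<not> (px = x \<and> py = y)"
  shows "\<not> (qx \<le> px \<and> px < k \<and> qy \<le> py \<and> py < h)"
  using assms unfolding tile_defs by (smt (verit))

text \<open>In the first two alternatives the other move takes a cross from the right or top edge of
  the forced ladder, in the next two it fills a bump of its frame. All four are pentagons; in the
  remaining one the moves commute. The third assumption is \<open>avoids\<close> unfolded.\<close>

lemma forced_ladder_interaction:
  assumes "forced_ladder D qx qy x y k h" "ladder D px py mx my"
    "\<not> (px \<le> qx \<and> py \<le> qy \<and> \<not> (px = qx \<and> py = qy))" "\<not> (px = x \<and> py = y)"
  shows "px = k \<and> y < py \<and> py < h \<and> my = h \<or>
     py = h \<and> x < px \<and> px < k \<and> mx = k \<or>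
     mx = x \<and> my = h \<and> py < y \<and> qx \<le> px \<and> px < x \<or>
     my = y \<and> mx = k \<and> px < x \<and> qy \<le> py \<and> py < y \<or>
     forced_ladder (relocate D px py mx my) qx qy x y k h \<and> ladder (relocate D x y k h) px py mx my"
    (is "?A \<or> ?B \<or> ?C \<or> ?D \<or> _")
proof -
  have R: "\<not> (qx \<le> px \<and> px < k \<and> qy \<le> py \<and> py < h)"
    using forced_ladder_other_cross assms by blast
  have *: "forced_ladder (relocate D px py mx my) qx qy x y k h" "ladder (relocate D x y k h) px py mx my"
    if "\<not> ?A" "\<not> ?B" "\<not> ?C" "\<not> ?D"
  proof -
    have E: "D a b" if "qx \<le> a \<and> a < k \<and> qy \<le> b \<and> b < h" for a b
      using assms(1) that unfolding forced_ladder_def by blast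
    have m: "\<not> (qx \<le> mx \<and> mx < k \<and> qy \<le> my \<and> my < h)"
      using assms(2) E unfolding ladder_def by blast
    have 1: "\<not> (mx = x \<and> my = h)"
      using assms that R unfolding tile_defs by (smt (verit))
    have 2: "\<not> (mx = k \<and> my = y)"
      using assms that R unfolding tile_defs by (smt (verit))
    have 3: "\<not> (mx = k \<and> my = h)"
      using assms that R unfolding tile_defs by (smt (verit))
    have 4: "\<not> (x \<le> px \<and> px \<le> k \<and> y \<le> py \<and> py \<le> h)"
      using assms that R unfolding tile_defs by (smt (verit))
    show "forced_ladder (relocate D px py mx my) qx qy x y k h"
      using assms(1,2) R 1 2 3 4 m unfolding tile_defs by auto
    have 5: "\<not> (px \<le> x \<and> x \<le> mx \<and> py \<le> y \<and> y \<le> my)"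
      using assms that R 1 2 3 4 m unfolding tile_defs by (smt (verit))
    have 6: "\<not> (px \<le> k \<and> k \<le> mx \<and> py \<le> h \<and> h \<le> my)"
      using assms that R 1 2 3 4 m unfolding tile_defs by (smt (verit))
    show "ladder (relocate D x y k h) px py mx my" 
      using assms(1,2) 3 4 5 6 unfolding tile_defs by auto
  qed
  then show ?thesis by blast
qed

text \<open>The analogue for two inverse moves: the second one fills a frame bump of the first, or
  takes a cross from its left or bottom edge, or commutes with it.\<close>

lemma inverse_ladder_interaction:
  assumes "inverse_ladder U x y k h" "inverse_ladder U rx ry mx my" "\<not> (rx = x \<and> ry = y)"
  shows "rx = x \<and> ry = h \<and> k < mx \<or> rx = k \<and> ry = y \<and> h < my \<or>
     mx = x \<and> ry = y \<and> rx < x \<and> y < my \<and> my < h \<or>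
     my = y \<and> rx = x \<and> ry < y \<and> x < mx \<and> mx < k \<or>
     inverse_ladder (relocate U mx my rx ry) x y k h \<and> inverse_ladder (relocate U k h x y) rx ry mx my"
  using assms unfolding tile_defs by (smt (verit))

section \<open>Forced moves\<close>

definition avoids :: "int \<Rightarrow> int \<Rightarrow> int \<Rightarrow> int \<Rightarrow> bool" where
  "avoids qx qy x y \<longleftrightarrow> \<not> (x \<le> qx \<and> y \<le> qy \<and> \<not> (x = qx \<and> y = qy))"

definition avoiding_step where
  "avoiding_step qx qy E E' \<longleftrightarrow> (\<exists>x y k h. ladder E x y k h \<and> avoids qx qy x y \<and> E' = relocate E x y k h)"

text \<open>Rows with nonpositive numbers are filled with crosses, so that no ladder reaches them.\<close>

definition bounded_grid :: "(int \<Rightarrow> int \<Rightarrow> bool) \<Rightarrow> bool" where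
  "bounded_grid E \<longleftrightarrow> (\<forall>a b. 0 \<le> b \<longrightarrow> E a b) \<and> finite {p. E (fst p) (snd p) \<and> snd p < 0}"

definition weight :: "(int \<Rightarrow> int \<Rightarrow> bool) \<Rightarrow> nat" where
  "weight E = (\<Sum>p \<in> {p. E (fst p) (snd p) \<and> snd p < 0}. nat (- snd p))"

lemma ladder_relocate: 
  assumes "ladder E x y k h" shows "inverse_ladder (relocate E x y k h) x y k h" "relocate (relocate E x y k h) k h x y = E"
proof -
  note A = assms[unfolded tile_defs]
  show "inverse_ladder (relocate E x y k h) x y k h" using A unfolding tile_defs by (smt (verit))
  show "relocate (relocate E x y k h) k h x y = E" using A unfolding tile_defs by (intro ext) (smt (verit))
qed

lemma inverse_ladder_relocate:
  assumes "inverse_ladder U x y k h" shows "ladder (relocate U k h x y) x y k h" "relocate (relocate U k h x y) x y k h = U"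
proof -
  note A = assms[unfolded tile_defs]
  show "ladder (relocate U k h x y) x y k h" using A unfolding tile_defs by (smt (verit))
  show "relocate (relocate U k h x y) x y k h = U" using A unfolding tile_defs by (intro ext) (smt (verit))
qed

lemma ladder_unique:
  assumes "ladder U x y k h" "ladder U x y k' h'" shows "k' = k \<and> h' = h"
  using assms unfolding tile_defs by (smt (verit))

lemma ladder_bounded:
  assumes "ladder E x y k h" "bounded_grid E"
  shows "bounded_grid (relocate E x y k h)" "weight (relocate E x y k h) < weight E"
proof -
  let ?S = "\<lambda>E. {p. E (fst p) (snd p) \<and> snd p < 0}"
  have *: "E x y" "\<not> E k h" "\<not> E x h" "y < h" "x < k" using assms unfolding tile_defs by auto
  then have neg: "h < 0" using assms(2) unfolding bounded_grid_def by (metis not_le)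
  have S: "?S (relocate E x y k h) = insert (k, h) (?S E - {(x, y)})"
    using neg unfolding relocate_def by auto
  have fin: "finite (?S E)" using assms(2) unfolding bounded_grid_def by simp
  show "bounded_grid (relocate E x y k h)"
    using assms(2) fin * neg S unfolding bounded_grid_def by (auto simp: relocate_def)
  have "(x, y) \<in> ?S E" using * neg by simp
  from sum.remove[OF fin this, of "\<lambda>p. nat (- snd p)"]
  have "weight E = nat (- y) + (\<Sum>p \<in> ?S E - {(x, y)}. nat (- snd p))" unfolding weight_def by simp
  moreover have "weight (relocate E x y k h) = nat (- h) + (\<Sum>p \<in> ?S E - {(x, y)}. nat (- snd p))"
    using fin * unfolding weight_def S by (subst sum.insert) auto
  ultimately show "weight (relocate E x y k h) < weight E" using * neg by simp
qed

lemma inverse_ladder_bounded: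
  assumes "inverse_ladder U x y k h" "bounded_grid U"
  shows "bounded_grid (relocate U k h x y)" "weight U < weight (relocate U k h x y)"
proof -
  let ?S = "\<lambda>E. {p. E (fst p) (snd p) \<and> snd p < 0}"
  have *: "\<not> U x y" "U k h" "\<not> U x h" "y < h" "x < k" using assms unfolding tile_defs by auto
  then have neg: "h < 0" using assms(2) unfolding bounded_grid_def by (metis not_le)
  have S: "?S (relocate U k h x y) = insert (x, y) (?S U - {(k, h)})"
    using neg * unfolding relocate_def by auto
  have fin: "finite (?S U)" using assms(2) unfolding bounded_grid_def by simp
  show g: "bounded_grid (relocate U k h x y)"
    using assms(2) fin * neg S unfolding bounded_grid_def by (auto simp: relocate_def)
  show "weight U < weight (relocate U k h x y)"
    using ladder_bounded(2)[OF inverse_ladder_relocate(1)[OF assms(1)] g] inverse_ladder_relocate(2)[OF assms(1)] by simp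
qed

lemma avoiding_stepI: "ladder E x y k h \<Longrightarrow> avoids qx qy x y \<Longrightarrow> E' = relocate E x y k h \<Longrightarrow> avoiding_step qx qy E E'"
  unfolding avoiding_step_def by blast

lemma avoiding_step_bounded: "avoiding_step qx qy E E' \<Longrightarrow> bounded_grid E \<Longrightarrow> bounded_grid E' \<and> weight E' < weight E"
  unfolding avoiding_step_def using ladder_bounded by blast

lemma avoiding_steps_bounded: "(avoiding_step qx qy)\<^sup>*\<^sup>* E E' \<Longrightarrow> bounded_grid E \<Longrightarrow> bounded_grid E' \<and> weight E' \<le> weight E"
  by (induction rule: rtranclp_induct) (auto dest: avoiding_step_bounded)

lemma pentagon_top:
  assumes "ladder D x y k h" "ladder D x1 h k h2" "x < x1"
  shows "ladder (relocate D x y k h) x1 y k h2"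
    "ladder (relocate D x1 h k h2) x1 y k h"
    "ladder (relocate (relocate D x1 h k h2) x1 y k h) x y x1 h"
    "relocate (relocate D x y k h) x1 y k h2 = relocate (relocate (relocate D x1 h k h2) x1 y k h) x y x1 h"
proof -
  note A = assms[unfolded tile_defs]
  show "ladder (relocate D x y k h) x1 y k h2" using A unfolding tile_defs by (smt (verit))
  show "ladder (relocate D x1 h k h2) x1 y k h" using A unfolding tile_defs by (smt (verit))
  show "ladder (relocate (relocate D x1 h k h2) x1 y k h) x y x1 h" using A unfolding tile_defs by (smt (verit))
  show "relocate (relocate D x y k h) x1 y k h2 = relocate (relocate (relocate D x1 h k h2) x1 y k h) x y x1 h"
    using A unfolding tile_defs by (intro ext) (smt (verit))
qed

lemma relocate_commute:
  assumes "ladder D x y k h" "ladder D px py mx my" "\<not> (px = x \<and> py = y)"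
  shows "relocate (relocate D px py mx my) x y k h = relocate (relocate D x y k h) px py mx my"
  using assms unfolding ladder_def relocate_def by (intro ext) auto

lemma forced_ladderD:
  assumes "forced_ladder D qx qy x y k h"
  shows "ladder D x y k h" "qx \<le> x" "qy \<le> y" "x < k" "y < h" "D qx qy"
proof -
  show *: "ladder D x y k h" "qx \<le> x" "qy \<le> y" using assms unfolding forced_ladder_def by blast+
  show **: "x < k" "y < h" using *(1) unfolding ladder_def ladder_frame_def by blast+
  have "qx < k" "qy < h" using * ** by linarith+
  then show "D qx qy" using assms unfolding forced_ladder_def by blast
qed

text \<open>A diamond argument against the first step of the chain. The chain is not empty, since
  \<open>q\<close> is a cross of \<open>D\<close> and a bump of \<open>U\<close>; the forced move,
  or its replacement in a pentagon, is again forced after that step.\<close>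

lemma forced_ladder_le:
  assumes "(avoiding_step qx qy)\<^sup>*\<^sup>* D U" "forced_ladder D qx qy x y k h" "\<not> U qx qy" "bounded_grid D"
  shows "(avoiding_step qx qy)\<^sup>*\<^sup>* (relocate D x y k h) U"
  using assms
proof (induction "weight D" arbitrary: D x y k h rule: less_induct)
  case less
  note F = less.prems(2)
  have ladder: "ladder D x y k h" using forced_ladderD[OF F] by blast
  have Dq: "D qx qy" using forced_ladderD[OF F] by blast
  then have "D \<noteq> U" using less.prems(3) by blast
  then obtain D' where D': "avoiding_step qx qy D D'" "(avoiding_step qx qy)\<^sup>*\<^sup>* D' U"
    by - (rule converse_rtranclpE[OF less.prems(1)], blast+)
  from D'(1) obtain px py mx my where p: "ladder D px py mx my" "avoids qx qy px py" "D' = relocate D px py mx my"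
    unfolding avoiding_step_def by blast
  have gD': "bounded_grid D'" "weight D' < weight D" using avoiding_step_bounded[OF D'(1) less.prems(4)] by auto
  have q: "qx \<le> x" "qy \<le> y" "x < k" "y < h" using forced_ladderD[OF F] by blast+
  have step: "(avoiding_step qx qy)\<^sup>*\<^sup>* E U" if "ladder E a b c d" "qx \<le> a" "qy \<le> b" "(avoiding_step qx qy)\<^sup>*\<^sup>* (relocate E a b c d) U" for E a b c d
  proof -
    have "avoids qx qy a b" using that(2,3) unfolding avoids_def by linarith
    then have "avoiding_step qx qy E (relocate E a b c d)" using avoiding_stepI[OF that(1)] by blast
    from converse_rtranclp_into_rtranclp[of "avoiding_step qx qy", OF this that(4)] show ?thesis .
  qed
  show ?case
  proof (cases "px = x \<and> py = y")
    case True
    then have "ladder D x y mx my" "D' = relocate D x y mx my" using p by auto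
    with ladder_unique[OF ladder this(1)] D'(2) show ?thesis by simp
  next
    case False
    consider (a) "px = k" "y < py" "py < h" "my = h" | (b) "py = h" "x < px" "px < k" "mx = k" 
      | (c) "mx = x" "my = h" "py < y" "qx \<le> px" "px < x" 
      | (d) "my = y" "mx = k" "px < x" "qy \<le> py" "py < y"
      | (e) "forced_ladder D' qx qy x y k h" "ladder (relocate D x y k h) px py mx my"
      using forced_ladder_interaction[OF F p(1) p(2)[unfolded avoids_def] False] unfolding p(3) by blast
    then show ?thesis
    proof cases
      case a
      \<comment> \<open>The chain enters the three-move side of the pentagon. Both remaining moves
        of this side are forced, so the induction hypothesis applies twice, and the end of the
        pentagon is also reached from the forced move.\<close>
      have l: "ladder D k py mx h" using p a by simp
      note P = pentagon_right[OF ladder l a(2)]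
      have F1: "forced_ladder D' qx qy x py k h"
        using F l P(2) a unfolding p(3) tile_defs by (smt (verit))
      have le1: "(avoiding_step qx qy)\<^sup>*\<^sup>* (relocate D' x py k h) U"
        by (rule less.hyps[OF gD'(2) D'(2) F1 less.prems(3) gD'(1)])
      have g1: "bounded_grid (relocate D' x py k h)" "weight (relocate D' x py k h) < weight D"
        using ladder_bounded[OF forced_ladderD(1)[OF F1] gD'(1)] gD'(2) by (blast, linarith)
      have F2: "forced_ladder (relocate D' x py k h) qx qy x y k py"
        using F l P(3) a unfolding p(3) tile_defs by (smt (verit))
      have "(avoiding_step qx qy)\<^sup>*\<^sup>* (relocate (relocate D' x py k h) x y k py) U"
        by (rule less.hyps[OF g1(2) le1 F2 less.prems(3) g1(1)])
      then show ?thesis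
        using step[OF P(1) q(1)] q a(2) unfolding P(4) p(3) a(1,4) by simp
    next
      case b
      have l: "ladder D px h k my" using p b by simp
      note P = pentagon_top[OF ladder l b(2)]
      have F1: "forced_ladder D' qx qy px y k h"
        using F l P(2) b unfolding p(3) tile_defs by (smt (verit))
      have le1: "(avoiding_step qx qy)\<^sup>*\<^sup>* (relocate D' px y k h) U"
        by (rule less.hyps[OF gD'(2) D'(2) F1 less.prems(3) gD'(1)])
      have g1: "bounded_grid (relocate D' px y k h)" "weight (relocate D' px y k h) < weight D"
        using ladder_bounded[OF forced_ladderD(1)[OF F1] gD'(1)] gD'(2) by (blast, linarith)
      have F2: "forced_ladder (relocate D' px y k h) qx qy x y px h"
        using F l P(3) b unfolding p(3) tile_defs by (smt (verit))
      have "(avoiding_step qx qy)\<^sup>*\<^sup>* (relocate (relocate D' px y k h) x y px h) U"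
        by (rule less.hyps[OF g1(2) le1 F2 less.prems(3) g1(1)])
      then show ?thesis
        using step[OF P(1) _ q(2)] q b(2) unfolding P(4) p(3) b(1,4) by simp
    next
      case c
      \<comment> \<open>Now the chain enters the two-move side, whose second move is forced. The
        forced move itself begins the three-move side; the last move there starts at the same tile
        as the step of the chain and hence avoids \<open>q\<close>.\<close>
      have l: "ladder D px py x h" using p c by simp
      note P = pentagon_right[OF l ladder c(3)]
      have F1: "forced_ladder D' qx qy px y k h"
        using F l P(1) c unfolding p(3) tile_defs by (smt (verit))
      have le1: "(avoiding_step qx qy)\<^sup>*\<^sup>* (relocate D' px y k h) U"
        by (rule less.hyps[OF gD'(2) D'(2) F1 less.prems(3) gD'(1)])
      have "avoiding_step qx qy (relocate (relocate D x y k h) px y x h) (relocate D' px y k h)"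
        by (rule avoiding_stepI[OF P(3) p(2)]) (simp only: p(3) c(1,2) P(4))
      then have "(avoiding_step qx qy)\<^sup>*\<^sup>* (relocate (relocate D x y k h) px y x h) U"
        using converse_rtranclp_into_rtranclp[of "avoiding_step qx qy", OF _ le1] by blast
      then show ?thesis
        by (rule step[OF P(2) c(4) q(2)])
    next
      case d
      have l: "ladder D px py k y" using p d by simp
      note P = pentagon_top[OF l ladder d(3)]
      have F1: "forced_ladder D' qx qy x py k h"
        using F l P(1) d unfolding p(3) tile_defs by (smt (verit))
      have le1: "(avoiding_step qx qy)\<^sup>*\<^sup>* (relocate D' x py k h) U"
        by (rule less.hyps[OF gD'(2) D'(2) F1 less.prems(3) gD'(1)])
      have "avoiding_step qx qy (relocate (relocate D x y k h) x py k y) (relocate D' x py k h)"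
        by (rule avoiding_stepI[OF P(3) p(2)]) (simp only: p(3) d(1,2) P(4))
      then have "(avoiding_step qx qy)\<^sup>*\<^sup>* (relocate (relocate D x y k h) x py k y) U"
        using converse_rtranclp_into_rtranclp[of "avoiding_step qx qy", OF _ le1] by blast
      then show ?thesis
        by (rule step[OF P(2) q(1) d(4)])
    next
      case e
      have le1: "(avoiding_step qx qy)\<^sup>*\<^sup>* (relocate D' x y k h) U"
        by (rule less.hyps[OF gD'(2) D'(2) e(1) less.prems(3) gD'(1)])
      have "avoiding_step qx qy (relocate D x y k h) (relocate D' x y k h)"
        by (rule avoiding_stepI[OF e(2) p(2)]) (simp only: p(3) relocate_commute[OF ladder p(1) False])
      from converse_rtranclp_into_rtranclp[of "avoiding_step qx qy", OF this le1] show ?thesis .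
    qed
  qed
qed

section \<open>Forced inverse moves\<close>

abbreviation linked :: "(int \<Rightarrow> int \<Rightarrow> bool) \<Rightarrow> int \<times> int \<Rightarrow> int \<times> int \<Rightarrow> bool" where
  "linked Z p p' \<equiv> link Z (fst p) (snd p) (fst p') (snd p')"

definition bump_above where "bump_above U x y \<longleftrightarrow> (\<exists>b>y. \<not> U x (b::int))"
definition bump_right where "bump_right U x y \<longleftrightarrow> (\<exists>a>x. \<not> U (a::int) y)"

lemma link_less: "link Z a b c d \<Longrightarrow> a < c \<and> b < d \<and> \<not> Z a b \<and> \<not> Z c d"
  unfolding link_def by simp

lemma linked_path_le:
  assumes "(linked Z)\<^sup>*\<^sup>* p p'" shows "fst p \<le> fst p' \<and> snd p \<le> snd p'"
  using assms by (induction rule: rtranclp_induct) (auto dest: link_less)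

lemma linked_path_transfer:
  assumes "(linked Z)\<^sup>*\<^sup>* p p'"
    and "\<And>a b c d. link Z a b c d \<Longrightarrow> fst p \<le> a \<Longrightarrow> snd p \<le> b \<Longrightarrow> c \<le> fst p' \<Longrightarrow> d \<le> snd p' \<Longrightarrow> R (a, b) (c, d)"
  shows "R\<^sup>*\<^sup>* p p'"
  using assms
proof (induction rule: rtranclp_induct)
  case (step y z)
  have 1: "fst y \<le> fst z" "snd y \<le> snd z" using link_less[OF step.hyps(2)] by auto
  have "R\<^sup>*\<^sup>* p y" using step.IH step.prems 1 order_trans by blast
  moreover have "R (fst y, snd y) (fst z, snd z)"
    using step.prems[OF step.hyps(2)] linked_path_le[OF step.hyps(1)] by simp
  ultimately show ?case by (simp add: rtranclp.rtrancl_into_rtrancl)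
qed simp

lemma link_relocate:
  assumes "link Z a b c d" "inverse_ladder Z x y k h" "c < x" "d < y"
  shows "link (relocate Z k h x y) a b c d"
  using assms unfolding tile_defs by (smt (verit))

text \<open>The nearest bumps above and to the right span the frame. If the rest of the box
  contained a bump, one at minimal distance from \<open>(x, y)\<close> would be the far end of a
  link.\<close>

lemma unlinked_inverse_ladder:
  assumes "\<not> U x y" "bump_above U x y" "bump_right U x y" "\<And>x' y'. \<not> link U x y x' y'"
  shows "\<exists>k h. inverse_ladder U x y k h"
proof -
  have least: "\<exists>b>c. \<not> P b \<and> (\<forall>b'. c < b' \<and> b' < b \<longrightarrow> P b')" if "\<exists>b>c. \<not> P b" for P and c :: int
  proof -
    from that obtain b where b: "b > c" "\<not> P b" by blast
    define n where "n = (LEAST n::nat. \<not> P (c + 1 + int n))"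
    have ex: "\<not> P (c + 1 + int (nat (b - c - 1)))" using b by simp
    have 1: "\<not> P (c + 1 + int n)" unfolding n_def by (rule LeastI[of "\<lambda>n. \<not> P (c + 1 + int n)", OF ex])
    have 2: "P (c + 1 + int m)" if "m < n" for m using not_less_Least that unfolding n_def by blast
    have "P b'" if "c < b'" "b' < c + 1 + int n" for b'
      using 2[of "nat (b' - c - 1)"] that by simp
    with 1 show ?thesis by (intro exI[of _ "c + 1 + int n"]) auto
  qed
  obtain h where h: "h > y" "\<not> U x h" "\<And>b. y < b \<Longrightarrow> b < h \<Longrightarrow> U x b"
    using least[of y "U x"] assms(2) unfolding bump_above_def by blast
  obtain k where k: "k > x" "\<not> U k y" "\<And>a. x < a \<Longrightarrow> a < k \<Longrightarrow> U a y"
    using least[of x "\<lambda>a. U a y"] assms(3) unfolding bump_right_def by blast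
  show ?thesis
  proof (cases "\<exists>a b. x < a \<and> a \<le> k \<and> y < b \<and> b \<le> h \<and> \<not> U a b")
    case True
    define Q where "Q = (\<lambda>p. x < fst p \<and> fst p \<le> k \<and> y < snd p \<and> snd p \<le> h \<and> \<not> U (fst p) (snd p))"
    from True obtain p0 where "Q p0" unfolding Q_def by force
    define p where "p = (ARG_MIN (\<lambda>p. nat (fst p - x + snd p - y)) p. Q p)"
    have p: "Q p" and min: "\<And>p'. Q p' \<Longrightarrow> nat (fst p - x + snd p - y) \<le> nat (fst p' - x + snd p' - y)"
      using arg_min_nat_lemma[of Q p0 "\<lambda>p. nat (fst p - x + snd p - y)", OF \<open>Q p0\<close>]
      unfolding p_def by blast+
    have "link U x y (fst p) (snd p)"
      unfolding link_def
    proof (intro conjI allI impI)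
      fix a b assume ab: "x \<le> a \<and> a \<le> fst p \<and> y \<le> b \<and> b \<le> snd p \<and> \<not> ((a = x \<or> a = fst p) \<and> (b = y \<or> b = snd p))"
      show "U a b"
      proof (cases "x < a \<and> y < b")
        case True
        show ?thesis using min[of "(a, b)"] p ab True unfolding Q_def by force
      next
        case False
        then show ?thesis using h(3)[of b] k(3)[of a] ab p assms(1) unfolding Q_def by force
      qed
    qed (use p assms(1) in \<open>auto simp: Q_def\<close>)
    with assms(4) show ?thesis by blast
  next
    case False
    have "inverse_ladder U x y k h" unfolding inverse_ladder_def ladder_frame_def
    proof (intro conjI allI impI)
      fix a b assume ab: "x \<le> a \<and> a \<le> k \<and> y \<le> b \<and> b \<le> h \<and> \<not> ((a = x \<or> a = k) \<and> (b = y \<or> b = h))"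
      show "U a b" using False h(3)[of b] k(3)[of a] ab by force
    qed (use h k False assms(1) in auto)
    then show ?thesis by blast
  qed
qed

text \<open>Links climb strictly, and bumps occur only in negative rows, so following links comes to
  an end.\<close>

lemma linked_inverse_ladder:
  assumes "\<not> Z (fst p) (snd p)" "\<And>b a. 0 \<le> b \<Longrightarrow> Z a b"
    and "\<And>c. (linked Z)\<^sup>*\<^sup>* p c \<Longrightarrow> bump_above Z (fst c) (snd c) \<and> bump_right Z (fst c) (snd c)"
  shows "\<exists>s k h. (linked Z)\<^sup>*\<^sup>* p s \<and> inverse_ladder Z (fst s) (snd s) k h"
  using assms(1,3)
proof (induction "nat (- snd p)" arbitrary: p rule: less_induct)
  case less
  show ?case
  proof (cases "\<exists>p'. linked Z p p'")
    case True
    then obtain p' where p': "linked Z p p'" by blast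
    then have n: "\<not> Z (fst p') (snd p')" "snd p < snd p'" by (auto dest: link_less)
    then have "snd p' < 0" using assms(2) not_le by blast
    then have lt: "nat (- snd p') < nat (- snd p)" using n(2) by simp
    obtain s k h where "(linked Z)\<^sup>*\<^sup>* p' s" "inverse_ladder Z (fst s) (snd s) k h"
      using less.hyps[OF lt n(1)] less.prems(2) converse_rtranclp_into_rtranclp[of "linked Z", OF p'] by blast
    then show ?thesis using converse_rtranclp_into_rtranclp[of "linked Z", OF p'] by blast
  next
    case False
    then have "\<And>x' y'. \<not> link Z (fst p) (snd p) x' y'" by force
    then show ?thesis
      using unlinked_inverse_ladder[of Z "fst p" "snd p"] less.prems(1) less.prems(2)[OF rtranclp.rtrancl_refl] by blast
  qed
qed

section \<open>Exchanging the last move of a chain\<close>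

lemma rtranclp_both:
  assumes "(\<lambda>p p'. A p p' \<and> B p p')\<^sup>*\<^sup>* x y" shows "A\<^sup>*\<^sup>* x y" "B\<^sup>*\<^sup>* x y"
  using assms by (induction rule: rtranclp_induct) (auto intro: rtranclp.rtrancl_into_rtrancl)

text \<open>
  \<open>W\<close> holds for the grids between the fixed lower element and \<open>U\<close>, excluding \<open>U\<close>; the assumptions are
  the induction hypotheses for these grids. The last move of a chain up to \<open>U\<close> enters the lemmas below
  as an inverse ladder with lower left corner \<open>(rx, ry)\<close> and upper right corner \<open>(mx, my)\<close>.
\<close>

locale undoing =
  fixes U :: "int \<Rightarrow> int \<Rightarrow> bool" and W :: "(int \<Rightarrow> int \<Rightarrow> bool) \<Rightarrow> bool" 
    and G :: "(int \<Rightarrow> int \<Rightarrow> bool) \<Rightarrow> bool" and wt' :: "(int \<Rightarrow> int \<Rightarrow> bool) \<Rightarrow> nat" and qx qy :: int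
  assumes Uq: "\<not> U qx qy"
    and W_ex: "\<And>Z c. W Z \<Longrightarrow> \<not> Z qx qy \<Longrightarrow> (linked Z)\<^sup>*\<^sup>* (qx, qy) c \<Longrightarrow>
      bump_above Z (fst c) (snd c) \<and> bump_right Z (fst c) (snd c) \<and>
      (\<exists>s k h. (linked Z)\<^sup>*\<^sup>* c s \<and> inverse_ladder Z (fst s) (snd s) k h)"
    and W_back: "\<And>Z x y k h. W Z \<Longrightarrow> \<not> Z qx qy \<Longrightarrow> (linked Z)\<^sup>*\<^sup>* (qx, qy) (x, y) \<Longrightarrow>
      inverse_ladder Z x y k h \<Longrightarrow> W (relocate Z k h x y)"
    and W_step: "\<And>Z x y k h. W Z \<Longrightarrow> ladder Z x y k h \<Longrightarrow> avoids qx qy x y \<Longrightarrow>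
      wt' U < wt' (relocate Z x y k h) \<Longrightarrow> W (relocate Z x y k h)"
    and GU: "G U" and WG: "\<And>Z. W Z \<Longrightarrow> G Z"
    and G_back: "\<And>Z x y k h. G Z \<Longrightarrow> inverse_ladder Z x y k h \<Longrightarrow> G (relocate Z k h x y) \<and> wt' Z < wt' (relocate Z k h x y)"
begin

text \<open>
  Undoing the last move breaks the links from \<open>(cx, cy)\<close> by creating the bump \<open>(cx, my)\<close> above it. In
  the first case this bump takes over the role of \<open>(cx, cy)\<close> after the latter has been filled; in the
  second one some other inverse ladder of \<open>U\<close> can serve as the last move.
\<close>

lemma left_break:
  assumes r: "inverse_ladder U rx cy cx my" "rx < cx" "cy < my" "avoids qx qy rx cy"
    and U': "U' = relocate U cx my rx cy" and W: "W U'"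
    and path: "(\<lambda>p p'. linked U p p' \<and> linked U' p p')\<^sup>*\<^sup>* (qx, qy) (cx, cy)"
  shows "(\<exists>k. inverse_ladder U' cx cy k my \<and> W (relocate U' k my cx cy) \<and> \<not> relocate U' k my cx cy qx qy \<and> 
              (linked (relocate U' k my cx cy))\<^sup>*\<^sup>* (qx, qy) (cx, my)) \<or>
     (\<nexists>k h. inverse_ladder U' cx cy k h) \<and>
     (\<exists>sx sy k h. cx < sx \<and> cy < sy \<and> inverse_ladder U sx sy k h \<and> W (relocate U k h sx sy) \<and> avoids qx qy sx sy \<and>
        (\<lambda>p p'. linked U p p' \<and> linked (relocate U k h sx sy) p p')\<^sup>*\<^sup>* (qx, qy) (cx, cy))"
proof -
  have pU: "(linked U)\<^sup>*\<^sup>* (qx, qy) (cx, cy)" and pU': "(linked U')\<^sup>*\<^sup>* (qx, qy) (cx, cy)"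
    using rtranclp_both[OF path] by blast+
  have ne: "(cx, cy) \<noteq> (qx, qy)" using r(2,4) unfolding avoids_def by auto
  have qle: "qx \<le> cx" "qy \<le> cy" using linked_path_le[OF pU] by auto
  obtain px py where p: "(\<lambda>p p'. linked U p p' \<and> linked U' p p')\<^sup>*\<^sup>* (qx, qy) (px, py)"
    "link U px py cx cy" "link U' px py cx cy"
  proof -
    from path show ?thesis
    proof (cases rule: rtranclp.cases)
      case (rtrancl_into_rtrancl b)
      with that[of "fst b" "snd b"] show ?thesis by simp
    qed (use ne in simp)
  qed
  have pU'2: "(linked U')\<^sup>*\<^sup>* (qx, qy) (px, py)"
    by (rule rtranclp_both(2)[OF p(1)])
  \<comment> \<open>The path is not trivial, so \<open>q\<close> has an outgoing link and cannot be
    the corner of the last move; hence \<open>q\<close> stays a bump when this move is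
    undone.\<close>
  have "\<exists>x y. link U qx qy x y"
    by (rule converse_rtranclpE[OF pU]) (use ne in auto)
  then have "(rx, cy) \<noteq> (qx, qy)" using inverse_ladder_no_link[OF r(1)] by auto
  then have U'q: "\<not> U' qx qy" using Uq unfolding U' relocate_def by auto
  have U'c: "\<not> U' cx cy" using link_less[OF p(3)] by simp
  have wU': "wt' U < wt' U'" using G_back[OF GU] r(1) unfolding U' by blast
  show ?thesis
  proof (cases "\<exists>x y. link U' cx cy x y")
    case True
    then obtain x y where xy: "link U' cx cy x y" by blast
    have "(linked U')\<^sup>*\<^sup>* (qx, qy) (x, y)" using pU' xy by (simp add: rtranclp.rtrancl_into_rtrancl)
    from W_ex[OF W U'q this] obtain sx sy k h
      where s: "(linked U')\<^sup>*\<^sup>* (x, y) (sx, sy)" "inverse_ladder U' sx sy k h" by auto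
    have lt: "cx < sx" "cy < sy" using link_less[OF xy] linked_path_le[OF s(1)] by auto
    have "(linked U')\<^sup>*\<^sup>* (qx, qy) (sx, sy)" using \<open>(linked U')\<^sup>*\<^sup>* (qx, qy) (x, y)\<close> s(1) by simp
    then have W1: "W (relocate U' k h sx sy)" using W_back[OF W U'q] s(2) by blast
    \<comment> \<open>Since \<open>(sx, sy)\<close> lies strictly to the upper right of
      \<open>(cx, cy)\<close>, the inverse move there commutes with the last move: undoing both and
      redoing the latter amounts to undoing only the former in \<open>U\<close>.\<close>
    have sU: "inverse_ladder U sx sy k h"
      using s(2) r lt unfolding U' tile_defs by (smt (verit))
    have l: "ladder (relocate U' k h sx sy) rx cy cx my"
      using s(2) r lt unfolding U' tile_defs by (smt (verit))
    have eq: "relocate (relocate U' k h sx sy) rx cy cx my = relocate U k h sx sy"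
      using s(2) r lt unfolding U' tile_defs by (intro ext) (smt (verit))
    have "wt' U < wt' (relocate U k h sx sy)" using G_back[OF GU] sU by blast
    then have W2: "W (relocate U k h sx sy)" using W_step[OF W1 l r(4)] unfolding eq by blast
    have "(\<lambda>p p'. linked U p p' \<and> linked (relocate U k h sx sy) p p')\<^sup>*\<^sup>* (qx, qy) (cx, cy)"
      by (rule linked_path_transfer[OF pU]) (use link_relocate[OF _ sU] lt in auto)
    moreover have "avoids qx qy sx sy" using lt qle unfolding avoids_def by auto
    moreover have "\<nexists>k h. inverse_ladder U' cx cy k h" using inverse_ladder_no_link xy by blast
    ultimately show ?thesis using lt sU W2 by blast
  next
    case False
    have "\<exists>k h. inverse_ladder U' cx cy k h"
      using unlinked_inverse_ladder[of U' cx cy] U'c W_ex[OF W U'q pU'] False by auto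
    then obtain k h where k0: "inverse_ladder U' cx cy k h" by blast
    \<comment> \<open>The nearest bump above \<open>(cx, cy)\<close> in \<open>U'\<close> is the one
      created by undoing the last move.\<close>
    have "h = my" using k0 r link_less[OF p(2)] unfolding U' tile_defs by (smt (verit))
    with k0 have k: "inverse_ladder U' cx cy k my" by simp
    let ?Z = "relocate U' k my cx cy"
    have WV: "W ?Z" by (rule W_back[OF W U'q pU' k])
    have Vq: "\<not> ?Z qx qy" using U'q ne unfolding relocate_def by auto
    have "(linked ?Z)\<^sup>*\<^sup>* (qx, qy) (px, py)"
      by (rule linked_path_transfer[OF pU'2]) (use link_relocate[OF _ k] link_less[OF p(2)] in auto)
    moreover have "link ?Z px py cx my"
      using p(2,3) r k unfolding U' tile_defs by (smt (verit))
    ultimately have "(linked ?Z)\<^sup>*\<^sup>* (qx, qy) (cx, my)" by (simp add: rtranclp.rtrancl_into_rtrancl)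
    with k WV Vq show ?thesis by blast
  qed
qed

definition undoable where
  "undoable x y \<longleftrightarrow> bump_above U x y \<and> bump_right U x y \<and> (\<forall>k h. inverse_ladder U x y k h \<longrightarrow> W (relocate U k h x y))"

lemma undoable_inverse_ladder:
  assumes "inverse_ladder U x y k h" "W (relocate U k h x y)" shows "undoable x y"
proof -
  have "y < h" "\<not> U x h" "x < k" "\<not> U k y" using assms(1) unfolding inverse_ladder_def ladder_frame_def by auto
  then show ?thesis
    using assms inverse_ladder_unique[OF assms(1)] unfolding undoable_def bump_above_def bump_right_def by blast
qed

lemma U'q:
  assumes "inverse_ladder U rx ry mx my" "\<not> (rx = qx \<and> ry = qy)"
  shows "\<not> relocate U mx my rx ry qx qy"
  using Uq assms unfolding relocate_def by auto

text \<open>The last move starts at the upper left bump of the frame. Undoing it and then the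
  enlarged inverse ladder at \<open>(x, y)\<close> leads to a grid in \<open>W\<close>, from which
  two moves lead up the other side of the pentagon to the desired grid.\<close>

lemma undo_below_NW:
  assumes e: "inverse_ladder U x y k h" and r: "inverse_ladder U x h mx my" "k < mx"
    and W: "W (relocate U mx my x h)" and path: "(linked (relocate U mx my x h))\<^sup>*\<^sup>* (qx, qy) (x, y)"
  shows "W (relocate U k h x y)"
proof -
  let ?U' = "relocate U mx my x h"
  have qle: "qx \<le> x" "qy \<le> y" using linked_path_le[OF path] by auto
  have lt: "x < k" "y < h" using e unfolding inverse_ladder_def ladder_frame_def by auto
  have q: "\<not> ?U' qx qy" using U'q[OF r(1)] qle lt by auto
  have 1: "inverse_ladder ?U' x y k my" using e r unfolding tile_defs by (smt (verit))
  let ?D = "relocate ?U' k my x y"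
  have WD: "W ?D" by (rule W_back[OF W q path 1])
  let ?Z = "relocate U k h x y"
  have GZ: "G ?Z" "wt' U < wt' ?Z" using G_back[OF GU e] by auto
  have 2: "inverse_ladder ?Z x h k my" using e r unfolding tile_defs by (smt (verit))
  let ?Y = "relocate ?Z k my x h"
  have wY: "wt' U < wt' ?Y" using G_back[OF GZ(1) 2] GZ(2) by auto
  have 3: "ladder ?D k h mx my" using e r unfolding tile_defs by (smt (verit))
  have 4: "relocate ?D k h mx my = ?Y" using e r unfolding tile_defs by (intro ext) (smt (verit))
  have "W ?Y"
    using W_step[OF WD 3] wY qle lt unfolding 4 by (auto simp: avoids_def)
  from W_step[OF this inverse_ladder_relocate(1)[OF 2]] inverse_ladder_relocate(2)[OF 2] GZ(2) qle lt
  show ?thesis by (auto simp: avoids_def)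
qed

text \<open>The bump above \<open>(cx, cy)\<close> in \<open>U'\<close> may be
  \<open>(cx, my)\<close>, which \<open>U\<close> lacks. A higher one is found above the substitute
  \<open>(cx, my)\<close>, or else by undoing another last move, which keeps the path.\<close>

lemma left_break_bump_above:
  assumes r: "inverse_ladder U rx cy cx my" "rx < cx" "cy < my" "avoids qx qy rx cy"
    and W: "W (relocate U cx my rx cy)"
    and path: "(\<lambda>p p'. linked U p p' \<and> linked (relocate U cx my rx cy) p p')\<^sup>*\<^sup>* (qx, qy) (cx, cy)"
  shows "bump_above U cx cy"
proof -
  let ?U' = "relocate U cx my rx cy"
  consider (I) k where "inverse_ladder ?U' cx cy k my" "W (relocate ?U' k my cx cy)" "\<not> relocate ?U' k my cx cy qx qy"
      "(linked (relocate ?U' k my cx cy))\<^sup>*\<^sup>* (qx, qy) (cx, my)"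
    | (II) sx sy k h where "cx < sx" "cy < sy" "inverse_ladder U sx sy k h" "W (relocate U k h sx sy)"
      "(\<lambda>p p'. linked U p p' \<and> linked (relocate U k h sx sy) p p')\<^sup>*\<^sup>* (qx, qy) (cx, cy)"
    using left_break[OF r refl W path] by blast
  then show ?thesis
  proof cases
    case I
    have "bump_above (relocate ?U' k my cx cy) cx my" using W_ex[OF I(2,3,4)] by simp
    then obtain b where b: "my < b" "\<not> relocate ?U' k my cx cy cx b" unfolding bump_above_def by blast
    have "cx < k" using I(1) unfolding inverse_ladder_def ladder_frame_def by blast
    then have "\<not> U cx b" using b r unfolding relocate_def by auto
    with b(1) r(3) show ?thesis unfolding bump_above_def by (meson less_trans)
  next
    case II
    have "\<not> relocate U k h sx sy qx qy" using U'q[OF II(3)] linked_path_le[OF rtranclp_both(1)[OF path]] II(1) by auto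
    from W_ex[OF II(4) this rtranclp_both(2)[OF II(5)]]
    obtain b where b: "cy < b" "\<not> relocate U k h sx sy cx b" unfolding bump_above_def by auto
    have "cx < k" using II(1,3) unfolding inverse_ladder_def ladder_frame_def by auto
    then have "\<not> U cx b" using b II(1) unfolding relocate_def by auto
    with b(1) show ?thesis unfolding bump_above_def by blast
  qed
qed

text \<open>After the last move and \<open>(cx, cy)\<close> have been undone, the substitute
  \<open>(cx, my)\<close> is undone as well; a single move from \<open>(rx, cy)\<close> to
  \<open>(k, my)\<close> then leads to the desired grid.\<close>

lemma left_break_end:
  assumes r: "inverse_ladder U rx cy cx my" "rx < cx" "cy < my" "avoids qx qy rx cy"
    and W: "W (relocate U cx my rx cy)"
    and path: "(\<lambda>p p'. linked U p p' \<and> linked (relocate U cx my rx cy) p p')\<^sup>*\<^sup>* (qx, qy) (cx, cy)"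
    and e: "inverse_ladder U cx cy k h" "my < h"
  shows "W (relocate U k h cx cy)"
proof -
  let ?U' = "relocate U cx my rx cy"
  have 1: "inverse_ladder ?U' cx cy k my" using r e unfolding tile_defs by (smt (verit))
  obtain k' where "inverse_ladder ?U' cx cy k' my" "W (relocate ?U' k' my cx cy)" "\<not> relocate ?U' k' my cx cy qx qy"
      "(linked (relocate ?U' k' my cx cy))\<^sup>*\<^sup>* (qx, qy) (cx, my)"
    using left_break[OF r refl W path] 1 by blast
  moreover have "k' = k" using inverse_ladder_unique[OF 1] calculation(1) by blast
  ultimately have V: "W (relocate ?U' k my cx cy)" "\<not> relocate ?U' k my cx cy qx qy"
      "(linked (relocate ?U' k my cx cy))\<^sup>*\<^sup>* (qx, qy) (cx, my)" by auto
  have 2: "inverse_ladder (relocate ?U' k my cx cy) cx my k h" using r e unfolding tile_defs by (smt (verit))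
  let ?D = "relocate (relocate ?U' k my cx cy) k h cx my"
  have WD: "W ?D" by (rule W_back[OF V 2])
  have 3: "ladder ?D rx cy k my" using r e unfolding tile_defs by (smt (verit))
  have 4: "relocate ?D rx cy k my = relocate U k h cx cy" using r e unfolding tile_defs by (intro ext) (smt (verit))
  have "wt' U < wt' (relocate U k h cx cy)" using G_back[OF GU e(1)] by simp
  then show ?thesis using W_step[OF WD 3 r(4)] unfolding 4 by blast
qed

text \<open>If \<open>(cx, my)\<close> takes over, the rest of the path lies above row
  \<open>my\<close> and is still reached through this bump; the inverse move at its end commutes
  with the two moves that are redone afterwards. Otherwise the other last move either keeps the next
  link or sits at its far end, where the path stops.\<close>

lemma left_break_link:
  assumes r: "inverse_ladder U rx cy cx my" "rx < cx" "cy < my" "avoids qx qy rx cy"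
    and W: "W (relocate U cx my rx cy)"
    and path: "(\<lambda>p p'. linked U p p' \<and> linked (relocate U cx my rx cy) p p')\<^sup>*\<^sup>* (qx, qy) (cx, cy)"
    and l: "link U cx cy x1 y1" "my < y1" and path1: "(linked U)\<^sup>*\<^sup>* (x1, y1) (ex, ey)"
  shows "undoable ex ey \<or> (\<exists>sx sy k h. inverse_ladder U sx sy k h \<and> W (relocate U k h sx sy) \<and> avoids qx qy sx sy \<and>
        (\<lambda>p p'. linked U p p' \<and> linked (relocate U k h sx sy) p p')\<^sup>*\<^sup>* (qx, qy) (x1, y1))"
proof -
  let ?U' = "relocate U cx my rx cy"
  have le1: "x1 \<le> ex" "y1 \<le> ey" using linked_path_le[OF path1] by auto
  have l1: "cx < x1" "cy < y1" using link_less[OF l(1)] by auto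
  consider (I) k where "inverse_ladder ?U' cx cy k my" "W (relocate ?U' k my cx cy)" "\<not> relocate ?U' k my cx cy qx qy"
      "(linked (relocate ?U' k my cx cy))\<^sup>*\<^sup>* (qx, qy) (cx, my)"
    | (II) sx sy k h where "cx < sx" "cy < sy" "inverse_ladder U sx sy k h" "W (relocate U k h sx sy)"
      "avoids qx qy sx sy"
      "(\<lambda>p p'. linked U p p' \<and> linked (relocate U k h sx sy) p p')\<^sup>*\<^sup>* (qx, qy) (cx, cy)"
    using left_break[OF r refl W path] by blast
  then show ?thesis
  proof cases
    case I
    let ?V = "relocate ?U' k my cx cy"
    have "link ?V cx my x1 y1" using I(1) r l unfolding tile_defs by (smt (verit))
    then have "(linked ?V)\<^sup>*\<^sup>* (qx, qy) (x1, y1)" using I(4) by (simp add: rtranclp.rtrancl_into_rtrancl)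
    moreover have "(linked ?V)\<^sup>*\<^sup>* (x1, y1) (ex, ey)"
    proof (rule linked_path_transfer[OF path1])
      fix a b c d assume "link U a b c d" "fst (x1, y1) \<le> a" "snd (x1, y1) \<le> b"
      then have "link U a b c d" "my < b" "cy < b" using l(2) l1 by auto
      then have "link ?V a b c d" unfolding tile_defs by (smt (verit))
      then show "linked ?V (a, b) (c, d)" by simp
    qed
    ultimately have pe: "(linked ?V)\<^sup>*\<^sup>* (qx, qy) (ex, ey)" by simp
    have "bump_above ?V ex ey" "bump_right ?V ex ey" using W_ex[OF I(2,3) pe] by auto
    then have ur: "bump_above U ex ey" "bump_right U ex ey"
      using le1 l(2) unfolding bump_above_def bump_right_def relocate_def by (smt (verit))+
    have "W (relocate U kk hh ex ey)" if e: "inverse_ladder U ex ey kk hh" for kk hh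
    proof -
      have ly: "my < ey" "cy < my" using le1 l(2) r(3) by auto
      have eV: "inverse_ladder ?V ex ey kk hh" using e ly unfolding tile_defs by (smt (verit))
      have eU': "inverse_ladder ?U' ex ey kk hh" using e ly unfolding tile_defs by (smt (verit))
      have 1: "W (relocate ?V kk hh ex ey)" by (rule W_back[OF I(2,3) pe eV])
      have 2: "ladder (relocate ?V kk hh ex ey) cx cy k my" 
        using inverse_ladder_relocate(1)[OF I(1)] eV ly unfolding tile_defs by (smt (verit))
      have 3: "relocate (relocate ?V kk hh ex ey) cx cy k my = relocate ?U' kk hh ex ey"
        using I(1) eU' ly unfolding tile_defs by (intro ext) (smt (verit))
      have w: "wt' U < wt' ?U'" "wt' ?U' < wt' (relocate ?U' kk hh ex ey)"
        using G_back[OF GU r(1)] G_back[OF WG[OF W] eU'] by auto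
      have "avoids qx qy cx cy" 
        using linked_path_le[OF rtranclp_both(1)[OF path]] unfolding avoids_def by auto
      from W_step[OF 1 2 this] w have 4: "W (relocate ?U' kk hh ex ey)" unfolding 3 by simp
      have 5: "ladder (relocate ?U' kk hh ex ey) rx cy cx my"
        using inverse_ladder_relocate(1)[OF r(1)] eU' ly unfolding tile_defs by (smt (verit))
      have 6: "relocate (relocate ?U' kk hh ex ey) rx cy cx my = relocate U kk hh ex ey"
        using r(1) e ly unfolding tile_defs by (intro ext) (smt (verit))
      from W_step[OF 4 5 r(4)] show ?thesis using G_back[OF GU e] unfolding 6 by simp
    qed
    with ur show ?thesis unfolding undoable_def by blast
  next
    case II
    have kh: "sx < k" "sy < h" using II(3) unfolding inverse_ladder_def ladder_frame_def by auto
    have "link (relocate U k h sx sy) cx cy x1 y1 \<or> sx = x1 \<and> sy = y1"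
      using link_inverse_ladder_cases[OF l(1) II(3)] II(1,2) kh by auto
    then show ?thesis
    proof
      assume "link (relocate U k h sx sy) cx cy x1 y1"
      then have "(\<lambda>p p'. linked U p p' \<and> linked (relocate U k h sx sy) p p')\<^sup>*\<^sup>* (qx, qy) (x1, y1)"
        using II(6) l(1) by (simp add: rtranclp.rtrancl_into_rtrancl)
      with II show ?thesis by blast
    next
      assume s: "sx = x1 \<and> sy = y1"
      have "(x1, y1) = (ex, ey)"
        by (rule converse_rtranclpE[OF path1]) (use inverse_ladder_no_link[OF II(3)] s in auto)
      with s undoable_inverse_ladder[OF II(3,4)] show ?thesis by simp
    qed
  qed
qed

end

section \<open>Reflection in an antidiagonal\<close>

definition reflect :: "(int \<Rightarrow> int \<Rightarrow> bool) \<Rightarrow> int \<Rightarrow> int \<Rightarrow> bool" where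
  "reflect E = (\<lambda>x y. E y x)"

lemma reflect_simps [simp]:
  "reflect E x y = E y x" "reflect (reflect E) = E" "bump_above (reflect E) x y = bump_right E y x" "bump_right (reflect E) x y = bump_above E y x"
  by (auto simp: reflect_def bump_above_def bump_right_def)

lemma reflect_ladder [simp]: "inverse_ladder (reflect E) x y k h = inverse_ladder E y x h k" "ladder (reflect E) x y k h = ladder E y x h k"
  unfolding inverse_ladder_def ladder_def ladder_frame_def reflect_def by blast+

lemma reflect_link: "link (reflect E) x y x' y' = link E y x y' x'"
  unfolding link_def reflect_def by blast

lemma reflect_relocate: "relocate (reflect E) x y k h = reflect (relocate E y x h k)"
  unfolding relocate_def reflect_def by (intro ext) blast

lemma reflect_avoids: "avoids qy qx y x = avoids qx qy x y"
  unfolding avoids_def by blast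

lemma rtranclp_swap:
  assumes "R\<^sup>*\<^sup>* p p'" shows "(\<lambda>a b. R (prod.swap a) (prod.swap b))\<^sup>*\<^sup>* (prod.swap p) (prod.swap p')"
  using assms by (induction rule: rtranclp_induct) (auto intro: rtranclp.rtrancl_into_rtrancl)

lemma reflect_linked_path: "(linked (reflect E))\<^sup>*\<^sup>* p p' \<longleftrightarrow> (linked E)\<^sup>*\<^sup>* (prod.swap p) (prod.swap p')"
  using rtranclp_swap[of "linked (reflect E)" p p'] rtranclp_swap[of "linked E" "prod.swap p" "prod.swap p'"]
  by (auto simp: reflect_link)

lemma reflect_linked_path2:
  "(\<lambda>p p'. linked (reflect E) p p' \<and> linked (reflect F) p p')\<^sup>*\<^sup>* p p' \<longleftrightarrow>
   (\<lambda>p p'. linked E p p' \<and> linked F p p')\<^sup>*\<^sup>* (prod.swap p) (prod.swap p')"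
  using rtranclp_swap[of "\<lambda>p p'. linked (reflect E) p p' \<and> linked (reflect F) p p'" p p']
    rtranclp_swap[of "\<lambda>p p'. linked E p p' \<and> linked F p p'" "prod.swap p" "prod.swap p'"] by (auto simp: reflect_link)

text \<open>Undoing a move creates the single bump \<open>(mx, my)\<close>. If this is the only one
  above \<open>(x, y)\<close>, then \<open>(x, y)\<close> lies below it on the right edge of the
  frame, where the only bump is the lower right corner.\<close>

lemma bump_above_relocate:
  assumes "inverse_ladder U rx ry mx my" "bump_above (relocate U mx my rx ry) x y" "\<not> U x y"
  shows "bump_above U x y \<or> mx = x \<and> ry = y \<and> rx < x \<and> y < my"
proof (rule ccontr)
  assume n: "\<not> ?thesis"
  from assms(2) obtain b where b: "y < b" "\<not> relocate U mx my rx ry x b" unfolding bump_above_def by blast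
  have "U x b" using n b(1) unfolding bump_above_def by blast
  then have m: "mx = x" "my = b" using b(2) unfolding relocate_def by auto
  have "ry \<le> y" using assms(1) n m(1) unfolding inverse_ladder_def ladder_frame_def bump_above_def by force
  moreover have "ry < y"
    using n m b calculation assms(1) unfolding inverse_ladder_def ladder_frame_def by auto
  ultimately have "U x y" using assms(1) m b(1) unfolding inverse_ladder_def ladder_frame_def by auto
  with assms(3) show False ..
qed

lemma bump_right_relocate:
  assumes "inverse_ladder U rx ry mx my" "bump_right (relocate U mx my rx ry) x y" "\<not> U x y"
  shows "bump_right U x y \<or> my = y \<and> rx = x \<and> ry < y \<and> x < mx"
  using bump_above_relocate[of "reflect U" ry rx my mx y x] assms by (simp add: reflect_relocate)

context undoing
begin

text \<open>This is why \<open>G\<close> and \<open>wt'\<close> are parameters: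
  \<open>bounded_grid\<close> and \<open>weight\<close> refer to rows and are not invariant under
  reflection, but their composites with \<open>reflect\<close> satisfy the same assumptions.\<close>

lemma undoing_reflect: "undoing (reflect U) (\<lambda>Z. W (reflect Z)) (\<lambda>Z. G (reflect Z)) (\<lambda>Z. wt' (reflect Z)) qy qx"
proof
  show "\<not> reflect U qy qx" using Uq by simp
  fix Z c
  assume "W (reflect Z)" "\<not> Z qy qx" "(linked Z)\<^sup>*\<^sup>* (qy, qx) c"
  then have "bump_above (reflect Z) (fst (prod.swap c)) (snd (prod.swap c)) \<and> bump_right (reflect Z) (fst (prod.swap c)) (snd (prod.swap c)) \<and>
     (\<exists>s k h. (linked (reflect Z))\<^sup>*\<^sup>* (prod.swap c) s \<and> inverse_ladder (reflect Z) (fst s) (snd s) k h)"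
    by (intro W_ex) (auto simp: reflect_linked_path)
  then show "bump_above Z (fst c) (snd c) \<and> bump_right Z (fst c) (snd c) \<and> (\<exists>s k h. (linked Z)\<^sup>*\<^sup>* c s \<and> inverse_ladder Z (fst s) (snd s) k h)"
    by (auto simp: reflect_linked_path)
next
  fix Z x y k h
  assume "W (reflect Z)" "\<not> Z qy qx" "(linked Z)\<^sup>*\<^sup>* (qy, qx) (x, y)" "inverse_ladder Z x y k h"
  then have "W (relocate (reflect Z) h k y x)" by (intro W_back) (auto simp: reflect_linked_path)
  then show "W (reflect (relocate Z k h x y))" by (simp add: reflect_relocate)
next
  fix Z x y k h
  assume "W (reflect Z)" "ladder Z x y k h" "avoids qy qx x y" "wt' (reflect (reflect U)) < wt' (reflect (relocate Z x y k h))"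
  then have "W (relocate (reflect Z) y x h k)" by (intro W_step) (auto simp: reflect_relocate reflect_avoids)
  then show "W (reflect (relocate Z x y k h))" by (simp add: reflect_relocate)
next
  show "G (reflect (reflect U))" using GU by simp
  show "G (reflect Z)" if "W (reflect Z)" for Z using WG that by blast
  fix Z x y k h assume "G (reflect Z)" "inverse_ladder Z x y k h"
  then show "G (reflect (relocate Z k h x y)) \<and> wt' (reflect Z) < wt' (reflect (relocate Z k h x y))"
    using G_back[of "reflect Z" y x h k] by (simp add: reflect_relocate)
qed

interpretation S: undoing "reflect U" "\<lambda>Z. W (reflect Z)" "\<lambda>Z. G (reflect Z)" "\<lambda>Z. wt' (reflect Z)" qy qx
  by (rule undoing_reflect)

lemma reflect_undoable: "S.undoable y x = undoable x y"
  unfolding S.undoable_def undoable_def by (auto simp: reflect_relocate)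

lemma undo_left_of_SE:
  assumes e: "inverse_ladder U x y k h" and r: "inverse_ladder U k y mx my" "h < my"
    and W: "W (relocate U mx my k y)" and path: "(linked (relocate U mx my k y))\<^sup>*\<^sup>* (qx, qy) (x, y)"
  shows "W (relocate U k h x y)"
  using S.undo_below_NW[of y x h k my mx] assms by (simp add: reflect_relocate reflect_linked_path)

lemma bottom_break_bump_right:
  assumes r: "inverse_ladder U cx ry mx cy" "ry < cy" "cx < mx" "avoids qx qy cx ry"
    and W: "W (relocate U mx cy cx ry)"
    and path: "(\<lambda>p p'. linked U p p' \<and> linked (relocate U mx cy cx ry) p p')\<^sup>*\<^sup>* (qx, qy) (cx, cy)"
  shows "bump_right U cx cy"
  using S.left_break_bump_above[of ry cx cy mx] assms 
  by (simp add: reflect_relocate reflect_avoids reflect_linked_path2[of U "relocate U mx cy cx ry" "(qy, qx)" "(cy, cx)", simplified])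

lemma bottom_break_end:
  assumes r: "inverse_ladder U cx ry mx cy" "ry < cy" "cx < mx" "avoids qx qy cx ry"
    and W: "W (relocate U mx cy cx ry)"
    and path: "(\<lambda>p p'. linked U p p' \<and> linked (relocate U mx cy cx ry) p p')\<^sup>*\<^sup>* (qx, qy) (cx, cy)"
    and e: "inverse_ladder U cx cy k h" "mx < k"
  shows "W (relocate U k h cx cy)"
  using S.left_break_end[of ry cx cy mx h k] assms 
  by (simp add: reflect_relocate reflect_avoids reflect_linked_path2[of U "relocate U mx cy cx ry" "(qy, qx)" "(cy, cx)", simplified])

lemma bottom_break_link:
  assumes r: "inverse_ladder U cx ry mx cy" "ry < cy" "cx < mx" "avoids qx qy cx ry"
    and W: "W (relocate U mx cy cx ry)"
    and path: "(\<lambda>p p'. linked U p p' \<and> linked (relocate U mx cy cx ry) p p')\<^sup>*\<^sup>* (qx, qy) (cx, cy)"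
    and l: "link U cx cy x1 y1" "mx < x1" and path1: "(linked U)\<^sup>*\<^sup>* (x1, y1) (ex, ey)"
  shows "undoable ex ey \<or> (\<exists>sx sy k h. inverse_ladder U sx sy k h \<and> W (relocate U k h sx sy) \<and> avoids qx qy sx sy \<and>
        (\<lambda>p p'. linked U p p' \<and> linked (relocate U k h sx sy) p p')\<^sup>*\<^sup>* (qx, qy) (x1, y1))"
proof -
  have "S.undoable ey ex \<or> (\<exists>sx sy k h. inverse_ladder (reflect U) sx sy k h \<and> W (reflect (relocate (reflect U) k h sx sy)) \<and> avoids qy qx sx sy \<and>
        (\<lambda>p p'. linked (reflect U) p p' \<and> linked (relocate (reflect U) k h sx sy) p p')\<^sup>*\<^sup>* (qy, qx) (y1, x1))"
  proof (rule S.left_break_link[of ry cx cy mx])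
    show "(\<lambda>p p'. linked (reflect U) p p' \<and> linked (relocate (reflect U) cy mx ry cx) p p')\<^sup>*\<^sup>* (qy, qx) (cy, cx)"
      unfolding reflect_relocate reflect_linked_path2 using path by simp
    show "(linked (reflect U))\<^sup>*\<^sup>* (y1, x1) (ey, ex)" unfolding reflect_linked_path using path1 by simp
  qed (use assms in \<open>simp_all add: reflect_relocate reflect_link reflect_avoids\<close>)
  then show ?thesis
  proof
    assume "S.undoable ey ex"
    then show ?thesis using reflect_undoable by blast
  next
    assume "\<exists>sx sy k h. inverse_ladder (reflect U) sx sy k h \<and> W (reflect (relocate (reflect U) k h sx sy)) \<and> avoids qy qx sx sy \<and>
        (\<lambda>p p'. linked (reflect U) p p' \<and> linked (relocate (reflect U) k h sx sy) p p')\<^sup>*\<^sup>* (qy, qx) (y1, x1)"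
    then obtain sx sy k h where *: "inverse_ladder (reflect U) sx sy k h" "W (reflect (relocate (reflect U) k h sx sy))" "avoids qy qx sx sy"
        "(\<lambda>p p'. linked (reflect U) p p' \<and> linked (relocate (reflect U) k h sx sy) p p')\<^sup>*\<^sup>* (qy, qx) (y1, x1)" by blast
    have "(\<lambda>p p'. linked U p p' \<and> linked (relocate U h k sy sx) p p')\<^sup>*\<^sup>* (qx, qy) (x1, y1)"
      using *(4) unfolding reflect_relocate reflect_linked_path2 by simp
    with *(1-3) have "inverse_ladder U sy sx h k \<and> W (relocate U h k sy sx) \<and> avoids qx qy sy sx \<and> 
      (\<lambda>p p'. linked U p p' \<and> linked (relocate U h k sy sx) p p')\<^sup>*\<^sup>* (qx, qy) (x1, y1)"
      by (simp add: reflect_relocate reflect_avoids)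
    then show ?thesis by blast
  qed
qed

text \<open>Here undoing the last move keeps the whole path, so only its interaction with the
  inverse ladder at the end \<open>(ex, ey)\<close> matters: four pentagons and one commuting
  square.\<close>

lemma undoable_base:
  assumes r: "inverse_ladder U rx ry mx my" "avoids qx qy rx ry" "W (relocate U mx my rx ry)"
    and path: "(\<lambda>p p'. linked U p p' \<and> linked (relocate U mx my rx ry) p p')\<^sup>*\<^sup>* (qx, qy) (ex, ey)"
    and eU: "\<not> U ex ey"
  shows "undoable ex ey"
proof (cases "rx = ex \<and> ry = ey")
  case True
  then show ?thesis using undoable_inverse_ladder r by blast
next
  case False
  let ?U' = "relocate U mx my rx ry"
  note pU = rtranclp_both(1)[OF path] and pU' = rtranclp_both(2)[OF path]
  have "\<not> (rx = qx \<and> ry = qy)"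
  proof
    assume q: "rx = qx \<and> ry = qy"
    have "\<exists>x y. link U qx qy x y"
      by (rule converse_rtranclpE[OF pU]) (use False q in auto)
    then show False using inverse_ladder_no_link r(1) q by blast
  qed
  then have q: "\<not> ?U' qx qy" using U'q[OF r(1)] by blast
  from W_ex[OF r(3) q pU'] have "bump_above ?U' ex ey" "bump_right ?U' ex ey" by auto
  then have ur: "bump_above U ex ey" "bump_right U ex ey"
    using bump_above_relocate[OF r(1) _ eU] bump_right_relocate[OF r(1) _ eU] left_break_bump_above[of rx ey ex my] bottom_break_bump_right[of ex ry mx ey] r path
    by blast+
  moreover have "W (relocate U k h ex ey)" if e: "inverse_ladder U ex ey k h" for k h
  proof -
    consider "rx = ex" "ry = h" "k < mx" | "rx = k" "ry = ey" "h < my"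
      | "mx = ex" "ry = ey" "rx < ex" "ey < my" "my < h"
      | "my = ey" "rx = ex" "ry < ey" "ex < mx" "mx < k"
      | "inverse_ladder ?U' ex ey k h" "inverse_ladder (relocate U k h ex ey) rx ry mx my"
      using inverse_ladder_interaction[OF e r(1) False] by blast
    then show ?thesis
    proof cases
      case 1 then show ?thesis using undo_below_NW[OF e] r pU' by blast
    next
      case 2 then show ?thesis using undo_left_of_SE[OF e] r pU' by blast
    next
      case 3 then show ?thesis using left_break_end[of rx ey ex my k h] r path e by blast
    next
      case 4 then show ?thesis using bottom_break_end[of ex ry mx ey k h] r path e by blast
    next
      case 5
      have W1: "W (relocate ?U' k h ex ey)" by (rule W_back[OF r(3) q pU' 5(1)])
      have l: "ladder (relocate ?U' k h ex ey) rx ry mx my"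
        using inverse_ladder_relocate(1)[OF 5(2)] 5 e r(1) False unfolding tile_defs by (smt (verit))
      have eq: "relocate (relocate ?U' k h ex ey) rx ry mx my = relocate U k h ex ey"
        using 5 e r(1) False unfolding tile_defs by (intro ext) (smt (verit))
      show ?thesis using W_step[OF W1 l r(2)] G_back[OF GU e] unfolding eq by simp
    qed
  qed
  ultimately show ?thesis unfolding undoable_def by blast
qed

text \<open>The induction runs along the path, with the invariant that undoing some last move keeps
  the links from \<open>q\<close> up to \<open>c\<close>. When the next link breaks, the last move
  is exchanged or the claim about \<open>e\<close> is already settled.\<close>

lemma undoable_path:
  assumes "(linked U)\<^sup>*\<^sup>* c e" "\<not> U (fst e) (snd e)"
    "inverse_ladder U rx ry mx my" "avoids qx qy rx ry" "W (relocate U mx my rx ry)"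
    "(\<lambda>p p'. linked U p p' \<and> linked (relocate U mx my rx ry) p p')\<^sup>*\<^sup>* (qx, qy) c"
  shows "undoable (fst e) (snd e)"
  using assms
proof (induction arbitrary: rx ry mx my rule: converse_rtranclp_induct)
  case base
  then show ?case using undoable_base[of rx ry mx my "fst e" "snd e"] by simp
next
  case (step c c1)
  note r = step.prems(2-4) and path = step.prems(5)
  obtain cx cy x1 y1 where c: "c = (cx, cy)" "c1 = (x1, y1)" by fastforce
  have l: "link U cx cy x1 y1" using step.hyps(1) c by simp
  have e: "(linked U)\<^sup>*\<^sup>* (x1, y1) (fst e, snd e)" using step.hyps(2) c by simp
  have path': "(\<lambda>p p'. linked U p p' \<and> linked (relocate U mx my rx ry) p p')\<^sup>*\<^sup>* (qx, qy) (cx, cy)"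
    using path c by simp
  have next': ?case if "undoable (fst e) (snd e) \<or> (\<exists>sx sy k h. inverse_ladder U sx sy k h \<and> W (relocate U k h sx sy) \<and> avoids qx qy sx sy \<and>
        (\<lambda>p p'. linked U p p' \<and> linked (relocate U k h sx sy) p p')\<^sup>*\<^sup>* (qx, qy) (x1, y1))"
    using that step.IH[OF step.prems(1)] c by blast
  consider "link (relocate U mx my rx ry) cx cy x1 y1" | "rx = x1" "ry = y1"
    | "mx = cx" "ry = cy" "rx < cx" "cy < my" "my < y1"
    | "my = cy" "rx = cx" "ry < cy" "cx < mx" "mx < x1"
    using link_inverse_ladder_cases[OF l r(1)] by blast
  then show ?case
  proof cases
    case 1
    have "(\<lambda>p p'. linked U p p' \<and> linked (relocate U mx my rx ry) p p')\<^sup>*\<^sup>* (qx, qy) (x1, y1)"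
      using path' l 1 by (simp add: rtranclp.rtrancl_into_rtrancl)
    then show ?thesis using next' r by blast
  next
    case 2
    have "(x1, y1) = (fst e, snd e)"
      by (rule converse_rtranclpE[OF e]) (use inverse_ladder_no_link[OF r(1)] 2 in auto)
    then have "rx = fst e" "ry = snd e" using 2 by auto
    then show ?thesis using undoable_inverse_ladder[OF r(1,3)] by simp
  next
    case 3
    show ?thesis by (rule next', rule left_break_link[of rx cy cx my]) (use 3 r path' l e in auto)
  next
    case 4
    show ?thesis by (rule next', rule bottom_break_link[of cx ry mx cy]) (use 4 r path' l e in auto)
  qed
qed

end

text \<open>Both claims are needed together: the first one, for grids strictly below
  \<open>U\<close>, yields the inverse ladders whose undoing the second one controls.\<close>

lemma undo_linked:
  assumes "(avoiding_step qx qy)\<^sup>*\<^sup>* D U" "D qx qy" "\<not> U qx qy" "bounded_grid D"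
  shows "((linked U)\<^sup>*\<^sup>* (qx, qy) c \<longrightarrow> bump_above U (fst c) (snd c) \<and> bump_right U (fst c) (snd c)) \<and>
    ((linked U)\<^sup>*\<^sup>* (qx, qy) (x, y) \<and> inverse_ladder U x y k h \<longrightarrow> (avoiding_step qx qy)\<^sup>*\<^sup>* D (relocate U k h x y))"
  using assms(1,3)
proof (induction "weight D - weight U" arbitrary: U c x y k h rule: less_induct)
  case less
  have gU: "bounded_grid U" "weight U \<le> weight D" using avoiding_steps_bounded[OF less.prems(1) assms(4)] by auto
  \<comment> \<open>The strict inequality excludes \<open>U\<close>, and with
    \<open>weight Z \<le> weight D\<close> it makes the truncated difference of the induction
    smaller.\<close>
  define W where "W = (\<lambda>Z. (avoiding_step qx qy)\<^sup>*\<^sup>* D Z \<and> weight U < weight Z)"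
  have W_good: "bounded_grid Z \<and> weight Z \<le> weight D" if "W Z" for Z
    using that avoiding_steps_bounded[OF _ assms(4)] unfolding W_def by blast
  have IH: "((linked Z)\<^sup>*\<^sup>* (qx, qy) c \<longrightarrow> bump_above Z (fst c) (snd c) \<and> bump_right Z (fst c) (snd c)) \<and>
    ((linked Z)\<^sup>*\<^sup>* (qx, qy) (x, y) \<and> inverse_ladder Z x y k h \<longrightarrow> (avoiding_step qx qy)\<^sup>*\<^sup>* D (relocate Z k h x y))"
    if "W Z" "\<not> Z qx qy" for Z c x y k h
    by (rule less.hyps) (use that W_good[OF that(1)] in \<open>auto simp: W_def\<close>)
  have un: "undoing U W bounded_grid weight qx qy"
  proof
    show "\<not> U qx qy" "bounded_grid U" using less.prems(2) gU by auto
  next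
    fix Z c assume Z: "W Z" "\<not> Z qx qy" "(linked Z)\<^sup>*\<^sup>* (qx, qy) c"
    have N: "bump_above Z (fst c') (snd c') \<and> bump_right Z (fst c') (snd c')" if "(linked Z)\<^sup>*\<^sup>* (qx, qy) c'" for c'
      using IH[OF Z(1,2)] that by blast
    have "\<not> Z (fst c) (snd c)"
      using Z(3) by (cases rule: rtranclp.cases) (use Z(2) in \<open>auto dest: link_less\<close>)
    moreover have "Z a b" if "0 \<le> b" for a b using W_good[OF Z(1)] that unfolding bounded_grid_def by blast
    ultimately have "\<exists>s k h. (linked Z)\<^sup>*\<^sup>* c s \<and> inverse_ladder Z (fst s) (snd s) k h"
      using linked_inverse_ladder[of Z c] N Z(3) rtranclp_trans[of "linked Z" "(qx, qy)" c] by blast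
    with N[OF Z(3)] show "bump_above Z (fst c) (snd c) \<and> bump_right Z (fst c) (snd c) \<and>
      (\<exists>s k h. (linked Z)\<^sup>*\<^sup>* c s \<and> inverse_ladder Z (fst s) (snd s) k h)" by blast
  next
    fix Z x y k h assume Z: "W Z" "\<not> Z qx qy" "(linked Z)\<^sup>*\<^sup>* (qx, qy) (x, y)" "inverse_ladder Z x y k h"
    have "weight Z < weight (relocate Z k h x y)" using inverse_ladder_bounded[OF Z(4)] W_good[OF Z(1)] by blast
    then show "W (relocate Z k h x y)" using IH[OF Z(1,2), of "(x, y)" x y k h] Z less_trans unfolding W_def by blast
  next
    fix Z x y k h assume Z: "W Z" "ladder Z x y k h" "avoids qx qy x y" "weight U < weight (relocate Z x y k h)"
    have "avoiding_step qx qy Z (relocate Z x y k h)" by (rule avoiding_stepI[OF Z(2,3) refl])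
    then show "W (relocate Z x y k h)" using Z(1,4) rtranclp.rtrancl_into_rtrancl[of "avoiding_step qx qy" D Z] unfolding W_def by blast
  next
    show "bounded_grid Z" if "W Z" for Z using W_good that by blast
    show "bounded_grid (relocate Z k h x y) \<and> weight Z < weight (relocate Z k h x y)" if "bounded_grid Z" "inverse_ladder Z x y k h" for Z x y k h
      using inverse_ladder_bounded that by blast
  qed
  interpret undoing U W bounded_grid weight qx qy by (rule un)
  have "D \<noteq> U" using assms(2) less.prems(2) by blast
  then obtain U' where U': "(avoiding_step qx qy)\<^sup>*\<^sup>* D U'" "avoiding_step qx qy U' U"
    by - (rule rtranclp.cases[OF less.prems(1)], simp_all)
  from U'(2) obtain rx ry mx my where r: "ladder U' rx ry mx my" "avoids qx qy rx ry" "U = relocate U' rx ry mx my"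
    unfolding avoiding_step_def by blast
  have r1: "inverse_ladder U rx ry mx my" and r2: "relocate U mx my rx ry = U'" using ladder_relocate[OF r(1)] r(3) by auto
  have WU': "W (relocate U mx my rx ry)"
    using U' avoiding_steps_bounded[OF U'(1) assms(4)] avoiding_step_bounded[OF U'(2)] unfolding r2 W_def by blast
  have undoable: "undoable (fst e) (snd e)" if "(linked U)\<^sup>*\<^sup>* (qx, qy) e" for e
  proof -
    have "\<not> U (fst e) (snd e)"
      using that by (cases rule: rtranclp.cases) (use less.prems(2) in \<open>auto dest: link_less\<close>)
    then show ?thesis using undoable_path[OF that _ r1 r(2) WU'] by blast
  qed
  show ?case
    using undoable[of c] undoable[of "(x, y)"] unfolding undoable_def by (auto simp: W_def)
qed

text \<open>The chain from \<open>D\<close> only guarantees that a link path from \<open>q\<close>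
  reaches an inverse ladder. The path and the ladder are found in \<open>U\<close> alone, so they
  serve every \<open>D'\<close>.\<close>

theorem undo_common:
  assumes "(avoiding_step qx qy)\<^sup>*\<^sup>* D U" "D qx qy" "\<not> U qx qy" "bounded_grid D"
  shows "\<exists>x y k h. inverse_ladder U x y k h \<and> avoids qx qy x y \<and>
    (\<forall>D'. (avoiding_step qx qy)\<^sup>*\<^sup>* D' U \<and> D' qx qy \<and> bounded_grid D' \<longrightarrow> (avoiding_step qx qy)\<^sup>*\<^sup>* D' (relocate U k h x y))"
proof -
  have "bounded_grid U" using avoiding_steps_bounded[OF assms(1,4)] by blast
  then have "U a b" if "0 \<le> b" for a b using that unfolding bounded_grid_def by blast
  then obtain s k h where s: "(linked U)\<^sup>*\<^sup>* (qx, qy) s" "inverse_ladder U (fst s) (snd s) k h"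
    using linked_inverse_ladder[of U "(qx, qy)"] undo_linked[OF assms] assms(3) by auto
  have "avoids qx qy (fst s) (snd s)" using linked_path_le[OF s(1)] unfolding avoids_def by auto
  moreover have "(avoiding_step qx qy)\<^sup>*\<^sup>* D' (relocate U k h (fst s) (snd s))"
    if "(avoiding_step qx qy)\<^sup>*\<^sup>* D' U" "D' qx qy" "bounded_grid D'" for D'
    using undo_linked[OF that(1,2) assms(3) that(3), of s "fst s" "snd s" k h] s by simp
  ultimately show ?thesis using s(2) by blast
qed

section \<open>Pipes and reducedness\<close>

text \<open>\<open>t i j\<close> and \<open>r i j\<close> are the pipes through the edges \<open>H i j\<close> and \<open>V i j\<close>.\<close>

definition labelling :: "pipe_dream \<Rightarrow> (nat \<Rightarrow> nat \<Rightarrow> nat) \<Rightarrow> (nat \<Rightarrow> nat \<Rightarrow> nat) \<Rightarrow> bool" where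
  "labelling D t r \<longleftrightarrow> (\<forall>j. t 0 (Suc j) = Suc j) \<and>
     (\<forall>i j. if (Suc i, Suc j) \<in> D then t (Suc i) (Suc j) = t i (Suc j) \<and> r (Suc i) j = r (Suc i) (Suc j)
       else t (Suc i) (Suc j) = r (Suc i) (Suc j) \<and> r (Suc i) j = t i (Suc j))"

lemma labellingD:
  assumes "labelling D t r"
  shows "t 0 (Suc j) = Suc j"
    "(Suc i, Suc j) \<in> D \<Longrightarrow> t (Suc i) (Suc j) = t i (Suc j)"
    "(Suc i, Suc j) \<in> D \<Longrightarrow> r (Suc i) j = r (Suc i) (Suc j)"
    "(Suc i, Suc j) \<notin> D \<Longrightarrow> t (Suc i) (Suc j) = r (Suc i) (Suc j)"
    "(Suc i, Suc j) \<notin> D \<Longrightarrow> r (Suc i) j = t i (Suc j)"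
  using assms unfolding labelling_def by (auto split: if_splits)

lemma labelling_cross:
  assumes "labelling D t r" "(i, j) \<in> D" "0 < i" "0 < j"
  shows "t i j = t (i - 1) j" "r i (j - 1) = r i j"
  using labellingD(2,3)[OF assms(1), of "i - 1" "j - 1"] assms(2-4) by auto

lemma labelling_bump:
  assumes "labelling D t r" "(i, j) \<notin> D" "0 < i" "0 < j"
  shows "t i j = r i j" "r i (j - 1) = t (i - 1) j"
  using labellingD(4,5)[OF assms(1), of "i - 1" "j - 1"] assms(2-4) by auto

section \<open>Existence and uniqueness of the edge labels\<close>

lemma finite_dream_bound:
  assumes "finite (D :: pipe_dream)" obtains N where "\<And>i j. (i, j) \<in> D \<Longrightarrow> i \<le> N \<and> j \<le> N"
proof -
  have "finite (fst ` D \<union> snd ` D)" using assms by simp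
  then obtain N where "\<forall>x \<in> fst ` D \<union> snd ` D. x \<le> N" using finite_nat_set_iff_bounded_le by blast
  then show thesis by (intro that[of N]) force
qed

text \<open>Rows are treated from the top. Within a row the induction starts to the right of all
  crosses, where every tile bumps a pipe from its top edge to its left edge.\<close>

lemma pipe_exists:
  assumes "finite D"
  shows "\<exists>x. on_pipe D x (H i (Suc j))" "\<exists>x. on_pipe D x (V (Suc i) j)"
proof -
  obtain N where N: "\<And>i j. (i, j) \<in> D \<Longrightarrow> i \<le> N \<and> j \<le> N" using finite_dream_bound[OF assms] by blast
  have V: "\<exists>x. on_pipe D x (V (Suc i) j)" if H: "\<And>j. \<exists>x. on_pipe D x (H i (Suc j))" for i j
  proof (cases "j \<le> N")
    case True
    then show ?thesis
    proof (induction j rule: inc_induct)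
      case base
      have "(Suc i, Suc N) \<notin> D" using N by force
      then show ?case using H on_pipe.bump_left by blast
    next
      case (step j)
      then show ?case using H on_pipe.bump_left on_pipe.cross_left by blast
    qed
  next
    case False
    then have "(Suc i, Suc j) \<notin> D" using N by force
    then show ?thesis using H on_pipe.bump_left by blast
  qed
  have H: "\<forall>j. \<exists>x. on_pipe D x (H i (Suc j))" for i
  proof (induction i)
    case 0
    show ?case using on_pipe.start[of _ D] by blast
  next
    case (Suc i)
    show ?case
    proof
      fix j
      obtain x y where "on_pipe D x (H i (Suc j))" "on_pipe D y (V (Suc i) (Suc j))"
        using Suc V[of i] by blast
      then show "\<exists>x. on_pipe D x (H (Suc i) (Suc j))"
        by (cases "(Suc i, Suc j) \<in> D") (blast intro: on_pipe.cross_down on_pipe.bump_down)+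
    qed
  qed
  then show "\<exists>x. on_pipe D x (H i (Suc j))" "\<exists>x. on_pipe D x (V (Suc i) j)" using V by blast+
qed

lemma pipe_unique: "on_pipe D x e \<Longrightarrow> on_pipe D y e \<Longrightarrow> x = y"
proof (induction arbitrary: y rule: on_pipe.induct)
  case start
  from start.prems show ?case by (cases rule: on_pipe.cases) auto
next
  case (cross_down i j) 
  from cross_down.prems show ?case by (cases rule: on_pipe.cases) (use cross_down.IH cross_down.hyps in blast)+
next
  case (cross_left i j)
  from cross_left.prems show ?case by (cases rule: on_pipe.cases) (use cross_left.IH cross_left.hyps in blast)+
next
  case (bump_left i j)
  from bump_left.prems show ?case by (cases rule: on_pipe.cases) (use bump_left.IH bump_left.hyps in blast)+
next
  case (bump_down i j)
  from bump_down.prems show ?case by (cases rule: on_pipe.cases) (use bump_down.IH bump_down.hyps in blast)+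
qed

lemma labelling_exists:
  assumes "finite D" obtains t r where "labelling D t r"
proof -
  define t r where "t = (\<lambda>i j. SOME x. on_pipe D x (H i j))" and "r = (\<lambda>i j. SOME x. on_pipe D x (V i j))"
  have t: "on_pipe D (t i (Suc j)) (H i (Suc j))" and r: "on_pipe D (r (Suc i) j) (V (Suc i) j)" for i j
    unfolding t_def r_def by (rule someI_ex, rule pipe_exists[OF assms])+
  have "labelling D t r"
    unfolding labelling_def
    using pipe_unique[OF t on_pipe.start] pipe_unique[OF t on_pipe.cross_down[OF t]]
      pipe_unique[OF t on_pipe.bump_down[OF r]] pipe_unique[OF r on_pipe.cross_left[OF r]]
      pipe_unique[OF r on_pipe.bump_left[OF t]] by auto
  then show thesis by (rule that)
qed

lemma on_pipe_labelling:
  assumes "labelling D t r" "on_pipe D x e"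
  shows "case e of H i j \<Rightarrow> x = t i j | V i j \<Rightarrow> x = r i j"
  using assms(2)
proof (induction rule: on_pipe.induct)
  case start then show ?case using labellingD(1)[OF assms(1), of "x - 1"] by simp
qed (use labellingD[OF assms(1)] in auto)

lemma labelling_on_pipe:
  assumes "labelling D t r" "finite D"
  shows "on_pipe D (t i (Suc j)) (H i (Suc j))" "on_pipe D (r (Suc i) j) (V (Suc i) j)"
  using pipe_exists[OF assms(2)] on_pipe_labelling[OF assms(1)] by fastforce+

lemma has_permutation_labelling:
  assumes "labelling D t r" "finite D"
  shows "has_permutation D w \<longleftrightarrow> (\<forall>i>0. r i 0 = w i)"
proof -
  have "on_pipe D (w i) (V i 0) \<longleftrightarrow> r i 0 = w i" if "0 < i" for i
    using labelling_on_pipe(2)[OF assms, of "i - 1" 0] on_pipe_labelling[OF assms(1), of "w i" "V i 0"] that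
    by auto
  then show ?thesis unfolding has_permutation_def by blast
qed

lemma on_pipe_column: "on_pipe D x e \<Longrightarrow> case e of H i j \<Rightarrow> 0 < j \<and> j \<le> x | V i j \<Rightarrow> j < x"
  by (induction rule: on_pipe.induct) auto

lemma labelling_column:
  assumes "labelling D t r" "finite D" 
  shows "0 < j \<Longrightarrow> j \<le> t i j" "0 < i \<Longrightarrow> j < r i j"
  using on_pipe_column[OF labelling_on_pipe(1)[OF assms, of i "j - 1"]]
    on_pipe_column[OF labelling_on_pipe(2)[OF assms, of "i - 1" j]] by auto

text \<open>The labels met along the cut below the first \<open>a\<close> rows and the tiles of row \<open>a + 1\<close> to the
  right of column \<open>j\<close>, read from the top left; a cross tile transposes two consecutive entries.\<close>

definition cut_label :: "(nat \<Rightarrow> nat \<Rightarrow> nat) \<Rightarrow> (nat \<Rightarrow> nat \<Rightarrow> nat) \<Rightarrow> nat \<Rightarrow> nat \<Rightarrow> nat \<Rightarrow> nat" where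
  "cut_label t r a j p = (if p \<le> a then r p 0 else if p \<le> a + j then t a (p - a)
     else if p = a + j + 1 then r (Suc a) j else t (Suc a) (p - a - 1))"

definition level_label :: "(nat \<Rightarrow> nat \<Rightarrow> nat) \<Rightarrow> (nat \<Rightarrow> nat \<Rightarrow> nat) \<Rightarrow> nat \<Rightarrow> nat \<Rightarrow> nat" where
  "level_label t r a p = (if p \<le> a then r p 0 else t a (p - a))"

lemma cut_label_bump:
  assumes "labelling D t r" "(Suc a, Suc j) \<notin> D" shows "cut_label t r a j p = cut_label t r a (Suc j) p"
proof -
  consider "p \<le> a + j" | "p = a + j + 1" | "p = a + j + 2" | "p > a + j + 2" by linarith
  then show ?thesis
    using labellingD(4,5)[OF assms] by cases (auto simp: cut_label_def)
qed

lemma cut_label_cross: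
  assumes "labelling D t r" "(Suc a, Suc j) \<in> D"
  shows "cut_label t r a j p = cut_label t r a (Suc j) (transpose (a + j + 1) (a + j + 2) p)"
proof -
  consider "p \<le> a + j" | "p = a + j + 1" | "p = a + j + 2" | "p > a + j + 2" by linarith
  then show ?thesis
    using labellingD(2,3)[OF assms] by cases (auto simp: cut_label_def transpose_def)
qed

lemma cut_label_0: "cut_label t r a 0 p = level_label t r (Suc a) p"
proof -
  consider "p \<le> a" | "p = Suc a" | "Suc a < p" by linarith
  then show ?thesis by cases (auto simp: cut_label_def level_label_def)
qed

lemma cut_label_far:
  assumes "labelling D t r" "\<And>j'. j \<le> j' \<Longrightarrow> (Suc a, Suc j') \<notin> D"
  shows "cut_label t r a j p = level_label t r a p"
proof -
  consider "p \<le> a + j" | "p = a + j + 1" | "a + j + 2 \<le> p" by linarith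
  then show ?thesis
  proof cases
    case 3
    then obtain d where "p = a + j + 2 + d" using le_Suc_ex by blast
    then obtain q where 3: "p = a + q + 2" "j \<le> q" by (metis add.assoc add.commute le_add1)
    have "t (Suc a) (Suc q) = t a (Suc (Suc q))"
      using labellingD(4,5)[OF assms(1)] assms(2)[of q] assms(2)[of "Suc q"] 3 by simp
    then show ?thesis using 3 by (auto simp: cut_label_def level_label_def)
  qed (use labellingD(5)[OF assms(1) assms(2)[OF order_refl]] in \<open>auto simp: cut_label_def level_label_def\<close>)
qed

text \<open>The cut sweeps over the tiles row by row, in each row from right to left, starting
  beyond the last cross. Bumps leave the sequence of labels unchanged.\<close>

lemma level_label_induct:
  assumes L: "labelling D t r" "finite D"
    and base: "P (level_label t r 0)"
    and cross: "\<And>a j f. (Suc a, Suc j) \<in> D \<Longrightarrow> P f \<Longrightarrow> f (a + j + 1) = t a (Suc j) \<Longrightarrow>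
      f (a + j + 2) = r (Suc a) (Suc j) \<Longrightarrow> P (f \<circ> transpose (a + j + 1) (a + j + 2))"
  shows "P (level_label t r a)"
proof (induction a)
  case (Suc a)
  obtain N where N: "\<And>i j. (i, j) \<in> D \<Longrightarrow> i \<le> N \<and> j \<le> N" using finite_dream_bound[OF L(2)] by blast
  have "P (cut_label t r a j)" if "j \<le> N" for j
    using that
  proof (induction j rule: inc_induct)
    case base
    have "cut_label t r a N = level_label t r a" 
      using cut_label_far[OF L(1), of N a] N by (intro ext) force
    then show ?case using Suc by simp
  next
    case (step j)
    show ?case
    proof (cases "(Suc a, Suc j) \<in> D")
      case True
      have eq: "cut_label t r a j = cut_label t r a (Suc j) \<circ> transpose (a + j + 1) (a + j + 2)"
        using cut_label_cross[OF L(1) True] by auto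
      show ?thesis
        unfolding eq by (rule cross[OF True step.IH]) (simp_all add: cut_label_def)
    next
      case False
      then have "cut_label t r a j = cut_label t r a (Suc j)" using cut_label_bump[OF L(1)] by auto
      then show ?thesis using step.IH by simp
    qed
  qed
  from this[of 0] show ?case using cut_label_0[of t r a] by (metis ext zero_le)
qed (rule base)

lemma level_label_inj:
  assumes L: "labelling D t r" "finite D" shows "inj_on (level_label t r a) {1..}"
proof (rule level_label_induct[OF L])
  have "level_label t r 0 p = p" if "1 \<le> p" for p
    using that labellingD(1)[OF L(1), of "p - 1"] by (simp add: level_label_def)
  then show "inj_on (level_label t r 0) {1..}" by (auto simp: inj_on_def)
next
  fix a j :: nat and f :: "nat \<Rightarrow> nat" assume "inj_on f {1..}"
  moreover have "transpose (a + j + 1) (a + j + 2) ` {1..} \<subseteq> {1..}"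
    by (auto simp: transpose_def)
  ultimately show "inj_on (f \<circ> transpose (a + j + 1) (a + j + 2)) {1..}"
    by (intro comp_inj_on) (auto intro: inj_on_subset)
qed

text \<open>The sequence starts in increasing order, and adjacent transpositions can reverse two
  entries only by exchanging exactly these two.\<close>

lemma level_label_order:
  assumes L: "labelling D t r" "finite D" and xy: "0 < x" "x < y"
    and no: "\<And>a j. (Suc a, Suc j) \<in> D \<Longrightarrow> {t a (Suc j), r (Suc a) (Suc j)} \<noteq> {x, y}"
  shows "\<exists>p p'. 1 \<le> p \<and> p < p' \<and> level_label t r a p = x \<and> level_label t r a p' = y"
proof (rule level_label_induct[OF L])
  have "level_label t r 0 p = p" if "1 \<le> p" for p
    using that labellingD(1)[OF L(1), of "p - 1"] by (simp add: level_label_def)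
  then have "level_label t r 0 x = x" "level_label t r 0 y = y" using xy by auto
  then show "\<exists>p p'. 1 \<le> p \<and> p < p' \<and> level_label t r 0 p = x \<and> level_label t r 0 p' = y"
    using xy by (intro exI[of _ x] exI[of _ y]) simp
next
  fix a j :: nat and f :: "nat \<Rightarrow> nat"
  let ?s = "transpose (a + j + 1) (a + j + 2)"
  assume a: "(Suc a, Suc j) \<in> D" "\<exists>p p'. 1 \<le> p \<and> p < p' \<and> f p = x \<and> f p' = y"
    "f (a + j + 1) = t a (Suc j)" "f (a + j + 2) = r (Suc a) (Suc j)"
  then obtain p p' where p: "1 \<le> p" "p < p'" "f p = x" "f p' = y" by blast
  have "\<not> (p = a + j + 1 \<and> p' = a + j + 2)" using no[OF a(1)] a(3,4) p(3,4) by auto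
  then have "1 \<le> ?s p \<and> ?s p < ?s p'" using p(1,2) by (auto simp: transpose_def)
  moreover have "(f \<circ> ?s) (?s p) = x" "(f \<circ> ?s) (?s p') = y" using p(3,4) by simp_all
  ultimately show "\<exists>p p'. 1 \<le> p \<and> p < p' \<and> (f \<circ> ?s) p = x \<and> (f \<circ> ?s) p' = y" by blast
qed

section \<open>Crossings of pipes and inversions\<close>

definition crossing :: "(nat \<Rightarrow> nat \<Rightarrow> nat) \<Rightarrow> (nat \<Rightarrow> nat \<Rightarrow> nat) \<Rightarrow> nat \<times> nat \<Rightarrow> nat set" where
  "crossing t r c = {t (fst c - 1) (snd c), r (fst c) (snd c)}"

lemma inversion_crossing:
  assumes L: "labelling D t r" "finite D" and w: "has_permutation D w" and ij: "(i, j) \<in> inversions w"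
  shows "\<exists>c \<in> D. crossing t r c = {w i, w j}"
proof (rule ccontr)
  assume n: "\<not> ?thesis"
  have rw: "r p 0 = w p" if "0 < p" for p using w that has_permutation_labelling[OF L] by blast
  have *: "0 < i" "i < j" "w j < w i" using ij unfolding inversions_def by auto
  have "0 < w j" using labelling_column(2)[OF L, of j 0] rw[of j] * by simp
  moreover have "{t a (Suc b), r (Suc a) (Suc b)} \<noteq> {w j, w i}" if "(Suc a, Suc b) \<in> D" for a b
  proof
    assume "{t a (Suc b), r (Suc a) (Suc b)} = {w j, w i}"
    then have "crossing t r (Suc a, Suc b) = {w i, w j}" unfolding crossing_def by auto
    with n that show False by blast
  qed
  ultimately obtain p p' where p: "1 \<le> p" "p < p'" "level_label t r j p = w j" "level_label t r j p' = w i"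
    using level_label_order[OF L _ *(3)] by blast
  have "level_label t r j j = w j" "level_label t r j i = w i" using * rw by (auto simp: level_label_def)
  then have "p = j" "p' = i" using p * level_label_inj[OF L, of j] by (auto simp: inj_on_def)
  then show False using p(2) * by simp
qed

text \<open>Choosing a crossing for each inversion gives an injection from the inversions into
  \<open>D\<close>, which is onto because the cardinalities agree.\<close>

lemma RPD_crossing:
  assumes D: "D \<in> RPD w" and L: "labelling D t r" and w: "inj w"
  shows "inj_on (crossing t r) D" "\<And>c. c \<in> D \<Longrightarrow> \<exists>(i, j) \<in> inversions w. crossing t r c = {w i, w j}"
proof -
  have fin: "finite D" and hp: "has_permutation D w" and card: "card D = card (inversions w)"
    using D unfolding RPD_def pipe_dream_def by auto
  define f where "f = (\<lambda>p. SOME c. c \<in> D \<and> crossing t r c = {w (fst p), w (snd p)})"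
  have f: "f p \<in> D" "crossing t r (f p) = {w (fst p), w (snd p)}" if "p \<in> inversions w" for p
    using someI_ex[of "\<lambda>c. c \<in> D \<and> crossing t r c = {w (fst p), w (snd p)}"]
      inversion_crossing[OF L fin hp, of "fst p" "snd p"] that unfolding f_def by auto
  have pair: "p = p'" if "p \<in> inversions w" "p' \<in> inversions w"
    "{w (fst p), w (snd p)} = {w (fst p'), w (snd p')}" for p p'
    using that injD[OF w] unfolding inversions_def doubleton_eq_iff by fastforce
  have inj: "inj_on f (inversions w)" using f(2) pair by (metis inj_onI)
  have "f ` inversions w = D"
    by (rule card_subset_eq[OF fin]) (use f(1) card card_image[OF inj] in auto)
  then show "inj_on (crossing t r) D"
    using f(2) pair by (smt (verit, best) imageE inj_onI)
  show "\<exists>(i, j) \<in> inversions w. crossing t r c = {w i, w j}" if c: "c \<in> D" for c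
  proof -
    obtain p where "p \<in> inversions w" "c = f p" using c \<open>f ` inversions w = D\<close> by blast
    then show ?thesis using f(2)[of p] by (intro bexI[of _ p]) (auto split: prod.split)
  qed
qed

lemma inversions_bound:
  assumes "w permutes {1..n}" "(i, j) \<in> inversions w" shows "w i \<le> n" "w j \<le> n"
proof -
  have *: "0 < i" "i < j" "w j < w i" using assms(2) unfolding inversions_def by auto
  have out: "w k = k" if "k > n" for k using permutes_not_in[OF assms(1)] that by simp
  have ins: "w k \<le> n" if "k \<le> n" for k
    by (cases "k = 0") (use permutes_in_image[OF assms(1), of k] permutes_not_in[OF assms(1)] that in auto)
  show "w i \<le> n" using * out[of i] out[of j] ins[of i] by (cases "i \<le> n") auto
  then show "w j \<le> n" using * by simp
qed

text \<open>Crosses involve only labels of inversions, which are at most \<open>n\<close>. So a pipe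
  \<open>x > n\<close> meets bumps only and descends like a staircase along its
  antidiagonal.\<close>

lemma outer_labels:
  assumes w: "w permutes {1..n}" and D: "D \<in> RPD w" and L: "labelling D t r"
  shows "\<And>x i. n < x \<Longrightarrow> i < x \<Longrightarrow> t i (x - i) = x" "(i, j) \<in> D \<Longrightarrow> i + j \<le> n"
proof -
  have fin: "finite D" and pos: "D \<subseteq> {1..} \<times> {1..}" using D unfolding RPD_def pipe_dream_def by auto
  have le: "t i (Suc j) \<le> n \<and> r (Suc i) (Suc j) \<le> n" if c: "(Suc i, Suc j) \<in> D" for i j
  proof -
    obtain a b where "(a, b) \<in> inversions w" "{t i (Suc j), r (Suc i) (Suc j)} = {w a, w b}"
      using RPD_crossing(2)[OF D L permutes_inj[OF w] c] unfolding crossing_def by auto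
    then show ?thesis using inversions_bound[OF w] by (metis doubleton_eq_iff)
  qed
  show outer: "t i (x - i) = x" if "n < x" "i < x" for x i
    using that(2)
  proof (induction i)
    case 0
    then show ?case using labellingD(1)[OF L, of "x - 1"] by simp
  next
    case (Suc i)
    then obtain j where j: "x - Suc i = Suc j" by (metis Suc_diff_Suc)
    then have xi: "x - i = Suc (Suc j)" using Suc.prems by simp
    have t: "t i (Suc (Suc j)) = x" using Suc.IH Suc.prems unfolding xi by simp
    have "(Suc i, Suc (Suc j)) \<notin> D" using le t that(1) by fastforce
    then have r: "r (Suc i) (Suc j) = x" using labellingD(5)[OF L] t by simp
    then have "(Suc i, Suc j) \<notin> D" using le that(1) by fastforce
    then show ?case using labellingD(4)[OF L] r j by simp
  qed
  \<comment> \<open>The antidiagonal \<open>i + j = n + 1\<close> is left out: there the pipe with a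
    large label enters through the right edge, which is seen only once the next tile is known to be
    a bump.\<close>
  have n2: "(i, j) \<notin> D" if "i + j > Suc n" for i j
  proof
    assume ij: "(i, j) \<in> D"
    then have p: "0 < i" "0 < j" using pos by auto
    have "t (i - 1) j = i - 1 + j" using outer[of "i - 1 + j" "i - 1"] that p by simp
    then have "i - 1 + j \<le> n" using le[of "i - 1" "j - 1"] ij p by simp
    then show False using that p by arith
  qed
  show "i + j \<le> n" if ij: "(i, j) \<in> D"
  proof (rule ccontr)
    assume n: "\<not> i + j \<le> n"
    have p: "0 < i" "0 < j" using ij pos by auto
    have "r i j = t (i - 1) (Suc j)" 
      using labelling_bump(2)[OF L n2[of i "Suc j"] p(1)] n by simp
    also have "\<dots> = i + j" using outer[of "i + j" "i - 1"] n p by simp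
    finally show False using le[of "i - 1" "j - 1"] ij p n by simp
  qed
qed


text \<open>Otherwise the pipes meeting at \<open>(i, j)\<close> would also meet at \<open>(h, k)\<close>.\<close>

lemma RPD_no_double_crossing:
  assumes D: "D \<in> RPD w" and w: "inj w" and hk: "1 \<le> h" "h < i" "1 \<le> j" "j < k"
    and bump: "(h, j) \<notin> D" "(i, k) \<notin> D"
    and cross: "\<And>p q. h \<le> p \<Longrightarrow> p \<le> i \<Longrightarrow> j \<le> q \<Longrightarrow> q \<le> k \<Longrightarrow> (p, q) \<noteq> (h, j) \<Longrightarrow> (p, q) \<noteq> (i, k) \<Longrightarrow> (p, q) \<in> D"
  shows False
proof -
  have fin: "finite D" using D unfolding RPD_def pipe_dream_def by auto
  obtain t r where L: "labelling D t r" using labelling_exists[OF fin] by blast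
  note tc = labelling_cross(1)[OF L] and rc = labelling_cross(2)[OF L]
  have tj: "t p j = t h j" if "h \<le> p" "p < i" for p
    using that
  proof (induction p rule: dec_induct)
    case (step p) then show ?case using tc[OF cross[of "Suc p" j]] hk by simp
  qed simp
  have tk: "t p k = t (h - 1) k" if "h \<le> p" "p < i" for p
    using that
  proof (induction p rule: dec_induct)
    case base then show ?case using tc[OF cross[of h k]] hk by simp
  next
    case (step p) then show ?case using tc[OF cross[of "Suc p" k]] hk by simp
  qed
  have rh: "r h q = r h k" if "j \<le> q" "q \<le> k" for q
    using that(2,1)
  proof (induction q rule: inc_induct)
    case (step q) then show ?case using rc[OF cross[of h "Suc q"]] hk by simp
  qed simp
  have ri: "r i q = r i (k - 1)" if "j \<le> q" "q \<le> k - 1" for q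
    using that(2,1)
  proof (induction q rule: inc_induct)
    case (step q) then show ?case using rc[OF cross[of i "Suc q"]] hk by simp
  qed simp
  have "t (i - 1) j = t h j" "t (i - 1) k = t (h - 1) k" using tj[of "i - 1"] tk[of "i - 1"] hk by simp_all
  moreover have "t h j = r h j" using labelling_bump(1)[OF L bump(1)] hk by simp
  moreover have "r i (k - 1) = t (i - 1) k" using labelling_bump(2)[OF L bump(2)] hk by simp
  ultimately have "crossing t r (i, j) = crossing t r (h, k)"
    using rh[of j] ri[of j] hk by (auto simp: crossing_def)
  moreover have "(i, j) \<in> D" "(h, k) \<in> D" using cross hk by auto
  ultimately show False using RPD_crossing(1)[OF D L w] hk by (auto dest: inj_onD)
qed

text \<open>Two pipes run along the boundary of the rectangle, cross at \<open>(i, j)\<close> and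
  touch at \<open>(h, k)\<close>. The move lets them cross at \<open>(h, k)\<close> and touch at
  \<open>(i, j)\<close>: their labels along the boundary are exchanged and all others stay.\<close>

lemma ladder_corner_RPD:
  assumes D: "D \<in> RPD w" and c: "ladder_corner D i j h k"
  shows "insert (h, k) (D - {(i, j)}) \<in> RPD w"
proof -
  let ?D = "insert (h, k) (D - {(i, j)})"
  have fin: "finite D" and pd: "pipe_dream D" and hp: "has_permutation D w" and card: "card D = card (inversions w)"
    using D unfolding RPD_def pipe_dream_def by auto
  have hk: "1 \<le> h" "h < i" "1 \<le> j" "j < k" 
    and n: "(i, j) \<in> D" "(h, j) \<notin> D" "(i, k) \<notin> D" "(h, k) \<notin> D"
    and cross: "\<And>p q. h \<le> p \<Longrightarrow> p \<le> i \<Longrightarrow> j \<le> q \<Longrightarrow> q \<le> k \<Longrightarrow> (p, q) \<noteq> (h, j) \<Longrightarrow> (p, q) \<noteq> (i, k) \<Longrightarrow> (p, q) \<noteq> (h, k) \<Longrightarrow> (p, q) \<in> D"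
    using c unfolding ladder_corner_def by auto
  obtain t r where L: "labelling D t r" using labelling_exists[OF fin] by blast
  note tc = labelling_cross(1)[OF L] and rc = labelling_cross(2)[OF L]
  define y x where "y = r h (k - 1)" and "x = r h k"
  have rh: "r h q = y" if "j \<le> q" "q \<le> k - 1" for q
    using that(2,1)
  proof (induction q rule: inc_induct)
    case (step q) then show ?case using rc[OF cross[of h "Suc q"]] hk by simp
  qed (simp add: y_def)
  have tk: "t p k = x" if "h \<le> p" "p < i" for p
    using that
  proof (induction p rule: dec_induct)
    case base then show ?case using labelling_bump(1)[OF L n(4)] hk by (simp add: x_def)
  next
    case (step p) then show ?case using tc[OF cross[of "Suc p" k]] hk by simp
  qed
  have tj: "t p j = y" if "h \<le> p" "p < i" for p
    using that
  proof (induction p rule: dec_induct)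
    case base then show ?case using labelling_bump(1)[OF L n(2)] rh[of j] hk by simp
  next
    case (step p) then show ?case using tc[OF cross[of "Suc p" j]] hk by simp
  qed
  have ri: "r i q = x" if "j \<le> q" "q \<le> k - 1" for q
    using that(2,1)
  proof (induction q rule: inc_induct)
    case base
    then show ?case using labelling_bump(2)[OF L n(3)] tk[of "i - 1"] hk by simp
  next
    case (step q) then show ?case using rc[OF cross[of i "Suc q"]] hk by simp
  qed
  define t' where "t' = (\<lambda>p q. if h \<le> p \<and> p < i \<and> q = j then x else if h \<le> p \<and> p < i \<and> q = k then y else t p q)"
  define r' where "r' = (\<lambda>p q. if j \<le> q \<and> q < k \<and> p = h then x else if j \<le> q \<and> q < k \<and> p = i then y else r p q)"
  have thk: "t (h - 1) k = y" using labelling_bump(2)[OF L n(4)] hk by (simp add: y_def)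
  have rest: "t i j = y" "r i (j - 1) = x" 
    using tc[OF n(1)] rc[OF n(1)] tj[of "i - 1"] ri[of j] hk by simp_all
  have "labelling ?D t' r'"
    unfolding labelling_def
  proof (intro conjI allI)
    show "t' 0 (Suc q) = Suc q" for q using labellingD(1)[OF L] hk by (simp add: t'_def)
    fix p q
    let ?P = "Suc p" and ?Q = "Suc q"
    consider (ij) "?P = i" "?Q = j" | (hk) "?P = h" "?Q = k" | (hj) "?P = h" "?Q = j" | (ik) "?P = i" "?Q = k"
      | (col) "h < ?P" "?P < i" "?Q = j \<or> ?Q = k" | (row) "?P = h \<or> ?P = i" "j < ?Q" "?Q < k"
      | (out) "\<not> (h \<le> ?P \<and> ?P \<le> i \<and> (?Q = j \<or> ?Q = k))" "\<not> (j \<le> ?Q \<and> ?Q \<le> k \<and> (?P = h \<or> ?P = i))"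
      by linarith
    then show "if (?P, ?Q) \<in> ?D then t' ?P ?Q = t' p ?Q \<and> r' ?P q = r' ?P ?Q
        else t' ?P ?Q = r' ?P ?Q \<and> r' ?P q = t' p ?Q"
    proof cases
      case ij
      then have "(?P, ?Q) \<notin> ?D" "p = i - 1" "q = j - 1" using hk by auto
      then show ?thesis using ij rest hk tk by (auto simp: t'_def r'_def)
    next
      case hk': hk
      then have "p = h - 1" "q = k - 1" "(?P, ?Q) \<in> ?D" by auto
      then show ?thesis using hk' hk thk by (auto simp: t'_def r'_def x_def)
    next
      case hj
      then have "(?P, ?Q) \<notin> ?D" "p = h - 1" "q = j - 1" using hk n by auto
      then show ?thesis using hj hk labelling_bump[OF L n(2)] by (auto simp: t'_def r'_def)
    next
      case ik
      then have "(?P, ?Q) \<notin> ?D" "p = i - 1" "q = k - 1" using hk n by auto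
      then show ?thesis using ik hk labelling_bump[OF L n(3)] by (auto simp: t'_def r'_def)
    next
      case col
      then have D: "(?P, ?Q) \<in> D" "(?P, ?Q) \<in> ?D" using cross[of ?P ?Q] hk by auto
      then show ?thesis using col hk labellingD(3)[OF L D(1)] by (auto simp: t'_def r'_def)
    next
      case row
      then have D: "(?P, ?Q) \<in> D" "(?P, ?Q) \<in> ?D" using cross[of ?P ?Q] hk by auto
      then show ?thesis using row hk labellingD(2)[OF L D(1)] by (auto simp: t'_def r'_def)
    next
      case out
      have iff: "(?P, ?Q) \<in> ?D \<longleftrightarrow> (?P, ?Q) \<in> D" using out hk by auto
      have "t' ?P ?Q = t ?P ?Q" "t' p ?Q = t p ?Q" "r' ?P ?Q = r ?P ?Q" "r' ?P q = r ?P q"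
        using out hk unfolding t'_def r'_def by auto
      then show ?thesis unfolding iff using labellingD[OF L] by simp
    qed
  qed
  moreover have finD: "finite ?D" using fin by simp
  moreover have "r' p 0 = r p 0" for p using hk by (simp add: r'_def)
  ultimately have "has_permutation ?D w"
    using hp has_permutation_labelling[OF L fin] has_permutation_labelling[of ?D t' r'] by simp
  moreover have "card ?D = card D" using card.remove[OF fin n(1)] fin n hk by simp
  moreover have "pipe_dream ?D" using pd hk unfolding pipe_dream_def by auto
  ultimately show ?thesis using card unfolding RPD_def by simp
qed

lemma ladder_step_RPD: "ladder_step D D' \<Longrightarrow> D \<in> RPD w \<Longrightarrow> D' \<in> RPD w"
  unfolding ladder_step_def ladder_movable_def using ladder_corner_RPD by (auto simp: ladder_move_eq)

text \<open>Pipes are traced backwards: the exits are prescribed by \<open>w\<close>, the labels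
  below row \<open>n\<close> by the staircases, and the tiles below and to the left of
  \<open>(i, j)\<close> agree.\<close>

lemma labels_agree:
  assumes w: "w permutes {1..n}" and D: "D \<in> RPD w" "D' \<in> RPD w"
    and L: "labelling D t r" "labelling D' t' r'"
    and eq: "\<And>p q. i < p \<Longrightarrow> (p, q) \<in> D \<longleftrightarrow> (p, q) \<in> D'"
    and eqi: "\<And>q. q < j \<Longrightarrow> (i, q) \<in> D \<longleftrightarrow> (i, q) \<in> D'" and ij: "0 < i" "0 < j"
  shows "t i j = t' i j" "r i (j - 1) = r' i (j - 1)"
proof -
  have fin: "finite D" "finite D'" and hp: "has_permutation D w" "has_permutation D' w"
    using D unfolding RPD_def pipe_dream_def by auto
  have r0: "r p 0 = r' p 0" if "0 < p" for p
    using hp has_permutation_labelling L fin that by metis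
  have row: "r (Suc p) q = r' (Suc p) q \<and> (\<forall>q' < q. t p (Suc q') = t' p (Suc q'))"
    if "\<And>q'. q' < q \<Longrightarrow> (Suc p, Suc q') \<in> D \<longleftrightarrow> (Suc p, Suc q') \<in> D'"
      "\<And>q'. t (Suc p) (Suc q') = t' (Suc p) (Suc q')" for p q
    using that(1)
  proof (induction q)
    case 0 then show ?case using r0 by simp
  next
    case (Suc q)
    then have IH: "r (Suc p) q = r' (Suc p) q" "\<forall>q' < q. t p (Suc q') = t' p (Suc q')" by auto
    have "r (Suc p) (Suc q) = r' (Suc p) (Suc q) \<and> t p (Suc q) = t' p (Suc q)"
      using Suc.prems[of q] IH(1) that(2)[of q] labellingD(2-5)[OF L(1), of p q] labellingD(2-5)[OF L(2), of p q]
      by (cases "(Suc p, Suc q) \<in> D") auto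
    with IH(2) show ?case by (simp add: less_Suc_eq)
  qed
  have far: "t p (Suc q) = t' p (Suc q)" if "n \<le> p" for p q
    using outer_labels(1)[OF w D(1) L(1), of "p + Suc q" p] outer_labels(1)[OF w D(2) L(2), of "p + Suc q" p] that
    by simp
  have t: "\<forall>q. t p (Suc q) = t' p (Suc q)" if "i \<le> p" for p
  proof (cases "p \<le> i + n")
    case True
    then show ?thesis using that
    proof (induction p rule: inc_induct)
      case base
      show ?case using far by simp
    next
      case (step p)
      show ?case
      proof
        fix q show "t p (Suc q) = t' p (Suc q)"
          using row[of "Suc q" p] eq[of "Suc p"] step by simp
      qed
    qed
  next
    case False
    then show ?thesis using far by simp
  qed
  show "t i j = t' i j" using t[OF order_refl] ij by (metis Suc_pred)
  show "r i (j - 1) = r' i (j - 1)"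
    using row[of "j - 1" "i - 1"] eqi t[OF order_refl] ij by simp
qed

text \<open>Without a bump above, pipe \<open>j\<close> runs straight down to the bottom edge of
  \<open>(i, j)\<close>. In \<open>D'\<close> the same pipe reaches this edge from the right, which
  is impossible because pipes never move to the right.\<close>

lemma disagreement_movable:
  assumes w: "w permutes {1..n}" and D: "D \<in> RPD w" "D' \<in> RPD w"
    and eq: "\<And>p q. i < p \<Longrightarrow> (p, q) \<in> D \<longleftrightarrow> (p, q) \<in> D'"
    and eqi: "\<And>q. q < j \<Longrightarrow> (i, q) \<in> D \<longleftrightarrow> (i, q) \<in> D'"
    and ij: "(i, j) \<in> D" "(i, j) \<notin> D'"
  shows "movable D i j"
proof (rule ccontr)
  assume n: "\<not> movable D i j"
  have fin: "finite D" "finite D'" and pos: "D \<subseteq> {1..} \<times> {1..}" 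
    using D unfolding RPD_def pipe_dream_def by auto
  then have p: "0 < i" "0 < j" using ij by auto
  obtain t r where L: "labelling D t r" using labelling_exists[OF fin(1)] by blast
  obtain t' r' where L': "labelling D' t' r'" using labelling_exists[OF fin(2)] by blast
  have up: "(h, j) \<in> D" if "0 < h" "h < i" for h using n ij that unfolding movable_def by auto
  have "t h j = j" if "h < i" for h
    using that
  proof (induction h)
    case 0 then show ?case using labellingD(1)[OF L, of "j - 1"] p by simp
  next
    case (Suc h) then show ?case using labelling_cross(1)[OF L up[of "Suc h"]] p by simp
  qed
  then have "t i j = j" using labelling_cross(1)[OF L ij(1)] p by simp
  moreover have "t i j = t' i j" by (rule labels_agree(1)[OF w D L L' eq eqi p])
  moreover have "t' i j = r' i j" using labelling_bump(1)[OF L' ij(2)] p by simp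
  ultimately show False using labelling_column(2)[OF L' fin(2) p(1), of j] by simp
qed

section \<open>Pipe dreams as grids, and runs of the move operators\<close>

section \<open>Move operators\<close>

text \<open>\<open>nat\<close> sends all columns \<open>x \<le> 0\<close> to column 0, which holds
  no cross of a pipe dream; so in negative rows these columns consist of bumps.\<close>

definition grid :: "pipe_dream \<Rightarrow> int \<Rightarrow> int \<Rightarrow> bool" where
  "grid D x y \<longleftrightarrow> 0 \<le> y \<or> (nat (- y), nat x) \<in> D"

lemma grid_int: "0 < i \<Longrightarrow> grid D (int j) (- int i) \<longleftrightarrow> (i, j) \<in> D"
  by (simp add: grid_def)

lemma grid_inj:
  assumes "grid D = grid D'" "pipe_dream D" "pipe_dream D'" shows "D = D'"
proof -
  have "(i, j) \<in> D \<longleftrightarrow> (i, j) \<in> D'" for i j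
    using grid_int[of i D j] grid_int[of i D' j] assms unfolding pipe_dream_def by (cases "0 < i") auto
  then show ?thesis by auto
qed

lemma grid_bounded:
  assumes "pipe_dream D" shows "bounded_grid (grid D)"
proof -
  have "{p. grid D (fst p) (snd p) \<and> snd p < 0} \<subseteq> (\<lambda>(i, j). (int j, - int i)) ` D"
  proof
    fix p :: "int \<times> int" assume p: "p \<in> {p. grid D (fst p) (snd p) \<and> snd p < 0}"
    then have m: "(nat (- snd p), nat (fst p)) \<in> D" by (auto simp: grid_def)
    then have "0 < nat (fst p)" using assms unfolding pipe_dream_def by auto
    then have "p = (case (nat (- snd p), nat (fst p)) of (i, j) \<Rightarrow> (int j, - int i))" 
      using p by (cases p) auto
    then show "p \<in> (\<lambda>(i, j). (int j, - int i)) ` D" using m by (rule image_eqI)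
  qed
  then have "finite {p. grid D (fst p) (snd p) \<and> snd p < 0}"
    using assms finite_subset unfolding pipe_dream_def by blast
  then show ?thesis unfolding bounded_grid_def by (simp add: grid_def)
qed

lemma ladder_corner_grid:
  assumes "ladder_corner D i j h k"
  shows "ladder (grid D) (int j) (- int i) (int k) (- int h)"
proof -
  note A = assms[unfolded ladder_corner_def]
  show ?thesis
    unfolding ladder_def ladder_frame_def
  proof (intro conjI allI impI)
    fix a b assume ab: "int j \<le> a \<and> a \<le> int k \<and> - int i \<le> b \<and> b \<le> - int h \<and>
      \<not> ((a = int j \<or> a = int k) \<and> (b = - int i \<or> b = - int h))"
    then have "nat (- b) \<in> {h..i}" "nat a \<in> {j..k}" "(nat (- b), nat a) \<notin> {(h, j), (i, k), (h, k)}"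
      by auto
    then show "grid D a b" using A by (auto simp: grid_def)
  qed (use A in \<open>auto simp: grid_int\<close>)
qed

lemma grid_ladder_corner:
  assumes "ladder (grid D) x y k h" "pipe_dream D"
  obtains i j h' k' where "x = int j" "y = - int i" "k = int k'" "h = - int h'" "ladder_corner D i j h' k'"
proof -
  have *: "x < k" "y < h" "\<not> grid D x h" "\<not> grid D k y" "grid D x y" "\<not> grid D k h"
    and box: "\<And>a b. x \<le> a \<Longrightarrow> a \<le> k \<Longrightarrow> y \<le> b \<Longrightarrow> b \<le> h \<Longrightarrow>
      \<not> ((a = x \<or> a = k) \<and> (b = y \<or> b = h)) \<Longrightarrow> grid D a b"
    using assms(1) unfolding ladder_def ladder_frame_def by blast+
  have h: "h < 0" using *(6) by (auto simp: grid_def)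
  then have "(nat (- y), nat x) \<in> D" using * by (auto simp: grid_def)
  then have x: "0 < x" using assms(2) unfolding pipe_dream_def by auto
  define i j h' k' where "i = nat (- y)" "j = nat x" "h' = nat (- h)" "k' = nat k"
  then have eq: "x = int j" "y = - int i" "k = int k'" "h = - int h'" using h x * by auto
  have pos: "0 < i" "0 < h'" "0 < j" "h' < i" "j < k'" using eq * h x by auto
  have "(p, q) \<in> D" if "p \<in> {h'..i}" "q \<in> {j..k'}" "(p, q) \<notin> {(h', j), (i, k'), (h', k')}" for p q
  proof (cases "p = i \<and> q = j")
    case True
    then show ?thesis using *(5) eq pos by (simp add: grid_int)
  next
    case False
    have "grid D (int q) (- int p)" by (rule box) (use that False eq in auto)
    then show ?thesis using that pos by (simp add: grid_int)
  qed
  then have "ladder_corner D i j h' k'"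
    using * eq pos unfolding ladder_corner_def by (auto simp: grid_int)
  with eq show thesis by (rule that)
qed

lemma relocate_grid:
  assumes "0 < i" "0 < j" "0 < h" "0 < k"
  shows "relocate (grid D) (int j) (- int i) (int k) (- int h) = grid (insert (h, k) (D - {(i, j)}))"
  unfolding relocate_def grid_def using assms by (intro ext) auto

definition late_step :: "nat \<Rightarrow> nat \<Rightarrow> pipe_dream \<Rightarrow> pipe_dream \<Rightarrow> bool" where
  "late_step i j D D' \<longleftrightarrow> (\<exists>a c h k. ladder_corner D a c h k \<and> \<not> (a, c) \<prec> (i, j) \<and>
     D' = insert (h, k) (D - {(a, c)}))"

definition forced_step :: "nat \<Rightarrow> nat \<Rightarrow> pipe_dream \<Rightarrow> pipe_dream \<Rightarrow> bool" where
  "forced_step i j D D' \<longleftrightarrow> (\<exists>a c h k. ladder_corner D a c h k \<and> a \<le> i \<and> j \<le> c \<and>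
     (\<forall>r s. h < r \<and> r \<le> i \<and> j \<le> s \<and> s < k \<longrightarrow> (r, s) \<in> D) \<and> D' = insert (h, k) (D - {(a, c)}))"

lemma ladder_step_iff:
  "ladder_step D D' \<longleftrightarrow> (\<exists>i j h k. ladder_corner D i j h k \<and> D' = insert (h, k) (D - {(i, j)}))"
proof
  assume "ladder_step D D'"
  then obtain i j h k where "ladder_corner D i j h k" "D' = ladder_move D i j"
    unfolding ladder_step_def ladder_movable_def by blast
  then show "\<exists>i j h k. ladder_corner D i j h k \<and> D' = insert (h, k) (D - {(i, j)})"
    using ladder_move_eq by blast
next
  assume "\<exists>i j h k. ladder_corner D i j h k \<and> D' = insert (h, k) (D - {(i, j)})"
  then obtain i j h k where c: "ladder_corner D i j h k" and D': "D' = insert (h, k) (D - {(i, j)})"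
    by blast
  have "D' = ladder_move D i j" unfolding D' by (rule ladder_move_eq[OF c, symmetric])
  then show "ladder_step D D'" using c unfolding ladder_step_def ladder_movable_def by blast
qed

lemma forced_step_ladder_step: "forced_step i j D D' \<Longrightarrow> ladder_step D D'"
  unfolding forced_step_def ladder_step_iff by blast

lemma forced_steps_ladder_steps: "(forced_step i j)\<^sup>*\<^sup>* D D' \<Longrightarrow> ladder_step\<^sup>*\<^sup>* D D'"
  by (rule rtranclp_mono[THEN predicate2D, of "forced_step i j"]) (use forced_step_ladder_step in blast)+

lemma ladder_corner_dream:
  "ladder_corner D i j h k \<Longrightarrow> pipe_dream D \<Longrightarrow> pipe_dream (insert (h, k) (D - {(i, j)}))"
  unfolding ladder_corner_def pipe_dream_def by auto

lemma ladder_step_dream: "ladder_step D D' \<Longrightarrow> pipe_dream D \<Longrightarrow> pipe_dream D'"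
  unfolding ladder_step_iff using ladder_corner_dream by blast

lemma ladder_steps_RPD: "ladder_step\<^sup>*\<^sup>* D D' \<Longrightarrow> D \<in> RPD w \<Longrightarrow> D' \<in> RPD w"
  by (induction rule: rtranclp_induct) (use ladder_step_RPD in blast)+

lemma relocate_grid_corner:
  assumes "ladder_corner D i j h k"
  shows "relocate (grid D) (int j) (- int i) (int k) (- int h) = grid (insert (h, k) (D - {(i, j)}))"
  by (rule relocate_grid) (use assms in \<open>auto simp: ladder_corner_def\<close>)

text \<open>A tile weakly to the south-west of \<open>(i, j)\<close> and different from it precedes
  \<open>(i, j)\<close>.\<close>

lemma late_steps_grid:
  assumes "(late_step i j)\<^sup>*\<^sup>* D U"
  shows "(avoiding_step (int j) (- int i))\<^sup>*\<^sup>* (grid D) (grid U)"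
  using assms
proof (induction rule: rtranclp_induct)
  case (step E F)
  then obtain a c h k where s: "ladder_corner E a c h k" "\<not> (a, c) \<prec> (i, j)" "F = insert (h, k) (E - {(a, c)})"
    unfolding late_step_def by blast
  have "avoids (int j) (- int i) (int c) (- int a)"
    using s(2) unfolding avoids_def prec_def by auto
  then have "avoiding_step (int j) (- int i) (grid E) (grid F)"
    by (rule avoiding_stepI[OF ladder_corner_grid[OF s(1)]]) (simp only: relocate_grid_corner[OF s(1)] s(3))
  with step.IH show ?case by (simp add: rtranclp.rtrancl_into_rtrancl)
qed simp

lemma avoiding_steps_grid:
  assumes "(avoiding_step qx qy)\<^sup>*\<^sup>* (grid D) X" "pipe_dream D"
  shows "\<exists>D'. X = grid D' \<and> pipe_dream D' \<and> ladder_step\<^sup>*\<^sup>* D D'"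
  using assms(1)
proof (induction rule: rtranclp_induct)
  case base then show ?case using assms(2) by blast
next
  case (step X Y)
  then obtain E where E: "X = grid E" "pipe_dream E" "ladder_step\<^sup>*\<^sup>* D E" by blast
  from step.hyps(2) obtain x y k h where s: "ladder (grid E) x y k h" "Y = relocate (grid E) x y k h"
    unfolding avoiding_step_def E(1) by (elim exE conjE) (rule that)
  obtain i j h' k' where c: "x = int j" "y = - int i" "k = int k'" "h = - int h'" "ladder_corner E i j h' k'"
    by (rule grid_ladder_corner[OF s(1) E(2)])
  have "Y = grid (insert (h', k') (E - {(i, j)}))" unfolding s(2) c(1-4) by (rule relocate_grid_corner[OF c(5)])
  moreover have "ladder_step E (insert (h', k') (E - {(i, j)}))" using c(5) ladder_step_iff by blast
  ultimately show ?case
    using ladder_corner_dream[OF c(5) E(2)] rtranclp.rtrancl_into_rtrancl[of ladder_step D E, OF E(3)]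
    by (intro exI[of _ "insert (h', k') (E - {(i, j)})"] conjI)
qed

lemma forced_step_grid:
  assumes "forced_step i j D D'"
  obtains x y k h where "forced_ladder (grid D) (int j) (- int i) x y k h" "grid D' = relocate (grid D) x y k h"
proof -
  from assms obtain a c h k where s: "ladder_corner D a c h k" "a \<le> i" "j \<le> c"
    "\<And>r s. h < r \<Longrightarrow> r \<le> i \<Longrightarrow> j \<le> s \<Longrightarrow> s < k \<Longrightarrow> (r, s) \<in> D" "D' = insert (h, k) (D - {(a, c)})"
    unfolding forced_step_def by blast
  have "grid D u v" if "int j \<le> u" "u < int k" "- int i \<le> v" "v < - int h" for u v
  proof -
    have "(nat (- v), nat u) \<in> D" by (rule s(4)) (use that in linarith)+
    then show ?thesis by (simp add: grid_def)
  qed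
  then have "forced_ladder (grid D) (int j) (- int i) (int c) (- int a) (int k) (- int h)"
    using ladder_corner_grid[OF s(1)] s(2,3) unfolding forced_ladder_def by auto
  moreover have "grid D' = relocate (grid D) (int c) (- int a) (int k) (- int h)"
    unfolding s(5) by (rule relocate_grid_corner[OF s(1), symmetric])
  ultimately show thesis by (rule that)
qed

lemma forced_steps_le:
  assumes "(forced_step i j)\<^sup>*\<^sup>* D D'" "(late_step i j)\<^sup>*\<^sup>* D U" "(i, j) \<notin> U" "0 < i" "pipe_dream D" "pipe_dream U"
  shows "ladder_step\<^sup>*\<^sup>* D' U"
proof -
  have U: "\<not> grid U (int j) (- int i)" using assms(3,4) by (simp add: grid_int)
  have "(avoiding_step (int j) (- int i))\<^sup>*\<^sup>* (grid D') (grid U) \<and> pipe_dream D'"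
    using assms(1)
  proof (induction rule: rtranclp_induct)
    case base then show ?case using late_steps_grid[OF assms(2)] assms(5) by simp
  next
    case (step E F)
    obtain x y k h where f: "forced_ladder (grid E) (int j) (- int i) x y k h" "grid F = relocate (grid E) x y k h"
      by (rule forced_step_grid[OF step.hyps(2)])
    have "(avoiding_step (int j) (- int i))\<^sup>*\<^sup>* (grid F) (grid U)"
      unfolding f(2)
      by (rule forced_ladder_le[where U = "grid U", OF _ f(1) U]) (use step.IH grid_bounded in blast)+
    then show ?case using step ladder_step_dream[OF forced_step_ladder_step] by blast
  qed
  then obtain U' where "grid U = grid U'" "pipe_dream U'" "ladder_step\<^sup>*\<^sup>* D' U'" using avoiding_steps_grid by blast
  then show ?thesis using grid_inj assms(6) by blast
qed

text \<open>The new cross lies strictly above row \<open>a\<close> and strictly to the right of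
  column \<open>b\<close>. So the bumps that bound the rectangle of a move survive the recursive
  calls.\<close>

lemma forced_step_keep:
  assumes "forced_step a b D D'" 
  shows "a < r \<or> s < b \<Longrightarrow> (r, s) \<in> D' \<longleftrightarrow> (r, s) \<in> D"
    "(r, b) \<notin> D \<Longrightarrow> (r, b) \<notin> D'" "(a, s) \<notin> D \<Longrightarrow> (a, s) \<notin> D'"
  using assms unfolding forced_step_def ladder_corner_def by auto

lemma forced_steps_keep:
  assumes "(forced_step a b)\<^sup>*\<^sup>* D D'" 
  shows "a < r \<or> s < b \<Longrightarrow> (r, s) \<in> D' \<longleftrightarrow> (r, s) \<in> D"
    "(r, b) \<notin> D \<Longrightarrow> (r, b) \<notin> D'" "(a, s) \<notin> D \<Longrightarrow> (a, s) \<notin> D'"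
  using assms by (induction rule: rtranclp_induct) (auto dest: forced_step_keep)

text \<open>Shows that the moves made by the recursive calls of the move operator are forced for the original tile.\<close>

lemma forced_steps_mono:
  assumes "(forced_step a b)\<^sup>*\<^sup>* D D'" "a \<le> i" "j \<le> b" "h < a" "b < k" "(h, b) \<notin> D" "(a, k) \<notin> D"
    and below: "\<And>r s. a < r \<Longrightarrow> r \<le> i \<Longrightarrow> j \<le> s \<Longrightarrow> s < k \<Longrightarrow> (r, s) \<in> D"
    and left: "\<And>r s. h < r \<Longrightarrow> r \<le> a \<Longrightarrow> j \<le> s \<Longrightarrow> s < b \<Longrightarrow> (r, s) \<in> D"
  shows "(forced_step i j)\<^sup>*\<^sup>* D D'"
  using assms(1)
proof (induction rule: rtranclp_induct)
  case (step E F)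
  note keep = forced_steps_keep[OF step.hyps(1)]
  from step.hyps(2) obtain a' c h' k' where s: "ladder_corner E a' c h' k'" "a' \<le> a" "b \<le> c"
    "\<And>r s. h' < r \<Longrightarrow> r \<le> a \<Longrightarrow> b \<le> s \<Longrightarrow> s < k' \<Longrightarrow> (r, s) \<in> E" "F = insert (h', k') (E - {(a', c)})"
    unfolding forced_step_def by blast
  have hk: "h' < a'" "c < k'" using s(1) unfolding ladder_corner_def by auto
  have k': "k' \<le> k"
  proof (rule ccontr)
    assume "\<not> k' \<le> k"
    then have "(a, k) \<in> E" using s(2) hk assms(5) by (intro s(4)) linarith+
    with keep(3)[OF assms(7)] show False by blast
  qed
  have h': "h \<le> h'"
  proof (rule ccontr)
    assume "\<not> h \<le> h'"
    then have "(h, b) \<in> E" using s(3) hk assms(4) by (intro s(4)) linarith+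
    with keep(2)[OF assms(6)] show False by blast
  qed
  have "(r, s') \<in> E" if "h' < r" "r \<le> i" "j \<le> s'" "s' < k'" for r s'
  proof -
    consider "a < r" | "r \<le> a" "s' < b" | "r \<le> a" "b \<le> s'" by linarith
    then show ?thesis
    proof cases
      case 1
      then have "(r, s') \<in> D" using that k' by (intro below) linarith+
      with keep(1)[of r s'] 1 show ?thesis by blast
    next
      case 2
      then have "(r, s') \<in> D" using that h' by (intro left) linarith+
      with keep(1)[of r s'] 2 show ?thesis by blast
    next
      case 3
      then show ?thesis using that by (intro s(4)) linarith+
    qed
  qed
  moreover have "a' \<le> i" "j \<le> c" using s(2,3) assms(2,3) by linarith+
  ultimately have "forced_step i j E F" using s(1,5) unfolding forced_step_def by blast
  with step.IH show ?case by (simp add: rtranclp.rtrancl_into_rtrancl)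
qed simp

lemma ladder_steps_sum_mono:
  "ladder_step\<^sup>*\<^sup>* D D' \<Longrightarrow> finite D \<Longrightarrow> sum fst D' \<le> sum fst D"
  using ladder_steps_sum_le by fastforce

text \<open>Two nested inductions mirror the recursion: the call on \<open>(a, j)\<close> or
  \<open>(i, b)\<close> keeps \<open>D\<close> and decreases \<open>i + (n - j)\<close>, the
  following call on \<open>(i, j)\<close> has a smaller sum of rows.\<close>

lemma move_forced_steps:
  assumes w: "w permutes {1..n}" and "D \<in> RPD w" "movable D i j"
  shows "\<exists>D'. move n D i j = Some D' \<and> (forced_step i j)\<^sup>*\<^sup>* D D' \<and> sum fst D' < sum fst D"
  using assms(2,3)
proof (induction "sum fst D" arbitrary: D i j rule: less_induct)
  case (less D)
  note outer = less.hyps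
  note D = \<open>D \<in> RPD w\<close>
  have fin: "finite D" and pos: "D \<subseteq> {1..} \<times> {1..}" using D unfolding RPD_def pipe_dream_def by auto
  have bound: "i + j \<le> n" if "(i, j) \<in> D" for i j
  proof -
    obtain t r where "labelling D t r" using labelling_exists[OF fin] by blast
    from outer_labels(2)[OF w D this that] show ?thesis .
  qed
  show ?case using \<open>movable D i j\<close>
  proof (induction "i + (n - j)" arbitrary: i j rule: less_induct)
    case (less i j)
    note inner = less.hyps
    have ij: "(i, j) \<in> D" and ex: "\<exists>h\<in>{1..<i}. (h, j) \<notin> D" using less.prems unfolding movable_def by auto
    have j: "1 \<le> j" "i + j \<le> n" using ij pos bound by auto
    define h where "h = rect_h D i j"
    define k where "k = rect_k n D i j"
    define a where "a = rect_a n D i j"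
    define b where "b = rect_b n D i j"
    have "h \<in> {h \<in> {1..<i}. (h, j) \<notin> D}" 
      unfolding h_def rect_h_def by (rule Max_in) (use ex in auto)
    then have h: "1 \<le> h" "h < i" "(h, j) \<notin> D" by auto
    have h_max: "(r, j) \<in> D" if "h < r" "r < i" for r
    proof (rule ccontr)
      assume "(r, j) \<notin> D"
      then have "r \<le> h" unfolding h_def rect_h_def using that by (intro Max_ge) auto
      with that show False by simp
    qed
    have "k \<in> {k \<in> {j+1..n}. (i, k) \<notin> D}"
      unfolding k_def rect_k_def
    proof (rule Min_in)
      \<comment> \<open>All crosses satisfy \<open>i + j \<le> n\<close>, so \<open>(i, n)\<close>
        is a bump and the minimum over columns up to \<open>n\<close> exists.\<close>
      have "n \<in> {k \<in> {j+1..n}. (i, k) \<notin> D}" using bound[of i n] j h by auto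
      then show "{k \<in> {j+1..n}. (i, k) \<notin> D} \<noteq> {}" by blast
    qed simp
    then have k: "j < k" "k \<le> n" "(i, k) \<notin> D" by auto
    have k_min: "(i, s) \<in> D" if "j < s" "s < k" for s
    proof (rule ccontr)
      assume "(i, s) \<notin> D"
      then have "k \<le> s" unfolding k_def rect_k_def using that k(2) k_def rect_k_def by (intro Min_le) auto
      with that show False by simp
    qed
    have Rect: "Rect n D i j = {h..i} \<times> {j..k}" unfolding Rect_def h_def k_def ..
    let ?A = "{p \<in> {h..<i}. \<exists>q. (p, q) \<in> {h..i} \<times> {j..k} \<and> (p, q) \<notin> D}"
    let ?B = "{q \<in> {j<..k}. \<exists>p. (p, q) \<in> {h..i} \<times> {j..k} \<and> (p, q) \<notin> D}"
    have a_def': "a = Max ?A" unfolding a_def rect_a_def Rect h_def[symmetric] ..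
    have b_def': "b = Min ?B" unfolding b_def rect_b_def Rect k_def[symmetric] ..
    have "h \<in> ?A" using h k by auto
    then have "a \<in> ?A" unfolding a_def' by (intro Max_in) auto
    then have a: "h \<le> a" "a < i" "\<exists>q. j \<le> q \<and> q \<le> k \<and> (a, q) \<notin> D" by auto
    have a_max: "(p, q) \<in> D" if "a < p" "p < i" "j \<le> q" "q \<le> k" for p q
    proof (rule ccontr)
      assume "(p, q) \<notin> D"
      then have "p \<le> a" unfolding a_def' using that a(1) a_def' by (intro Max_ge) auto
      with that show False by simp
    qed
    have "k \<in> ?B" using h k by (auto intro!: exI[of _ i])
    then have "b \<in> ?B" unfolding b_def' by (intro Min_in) auto
    then have b: "j < b" "b \<le> k" "\<exists>p. h \<le> p \<and> p \<le> i \<and> (p, b) \<notin> D" by auto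
    have b_min: "(p, q) \<in> D" if "j < q" "q < b" "h \<le> p" "p \<le> i" for p q
    proof (rule ccontr)
      assume "(p, q) \<notin> D"
      then have "b \<le> q" unfolding b_def' using that b(2) b_def' by (intro Min_le) auto
      with that show False by simp
    qed
    have corner: "ladder_corner D i j h k" if "a = h" "b = k"
    proof -
      have "(p, q) \<in> D" if "h \<le> p" "p \<le> i" "j \<le> q" "q \<le> k" "(p, q) \<noteq> (h, j)" "(p, q) \<noteq> (i, k)" "(p, q) \<noteq> (h, k)" for p q
        using that a_max[of p q] b_min[of q p] \<open>a = h\<close> \<open>b = k\<close> k_min[of q] ij h_max[of p]
        by (cases "p = h"; cases "p = i"; cases "q = j"; cases "q = k") auto
      \<comment> \<open>Otherwise the same two pipes would cross at \<open>(i, j)\<close> and at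
        \<open>(h, k)\<close>.\<close>
      moreover from this have "(h, k) \<notin> D"
        using RPD_no_double_crossing[OF D permutes_inj[OF w] h(1,2) j(1) k(1) h(3) k(3)] by blast
      ultimately show ?thesis using h k j ij unfolding ladder_corner_def by auto
    qed
    have sub: "?case" if c: "movable D p q" "move n D i j = Option.bind (move n D p q) (\<lambda>D'. move n D' i j)"
      "p + (n - q) < i + (n - j)" and mono: "\<And>E. (forced_step p q)\<^sup>*\<^sup>* D E \<Longrightarrow> (forced_step i j)\<^sup>*\<^sup>* D E"
      and keep: "p < i \<or> j < q" for p q
    proof -
      obtain E where E: "move n D p q = Some E" "(forced_step p q)\<^sup>*\<^sup>* D E" "sum fst E < sum fst D"
        using inner[OF c(3,1)] by blast
      have E_RPD: "E \<in> RPD w" using ladder_steps_RPD[OF forced_steps_ladder_steps[OF E(2)] D] .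
      have "(i, j) \<in> E" using forced_steps_keep(1)[OF E(2), of i j] keep ij by blast
      moreover have "(h, j) \<notin> E" using forced_steps_keep(2)[OF mono[OF E(2)] h(3)] .
      ultimately have "movable E i j" using h unfolding movable_def by auto
      from outer[OF E(3) E_RPD this] obtain E' where E': "move n E i j = Some E'" "(forced_step i j)\<^sup>*\<^sup>* E E'"
        "sum fst E' < sum fst E" by blast
      then show ?thesis using c(2) E mono[OF E(2)] by (intro exI[of _ E']) auto
    qed
    note move = move.simps[of n D i j, folded h_def k_def a_def b_def]
    show ?case
    proof (cases "a = h")
      case False
      then have ah: "h < a" using a(1) by simp
      show ?thesis
      proof (rule sub[of a j])
        show "movable D a j" unfolding movable_def using h_max[of a] ah a(2) h by auto
        show "move n D i j = Option.bind (move n D a j) (\<lambda>D'. move n D' i j)"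
          using move less.prems False ah by simp
        obtain q where q: "j \<le> q" "q \<le> k" "(a, q) \<notin> D" using a(3) by blast
        have "q \<noteq> j" using h_max[of a] ah a(2) q(3) by auto
        then have jq: "j < q" using q(1) by simp
        show "(forced_step i j)\<^sup>*\<^sup>* D E" if E: "(forced_step a j)\<^sup>*\<^sup>* D E" for E
        proof (rule forced_steps_mono[OF E _ order_refl ah jq h(3) q(3)])
          fix r s assume rs: "a < r" "r \<le> i" "j \<le> s" "s < q"
          show "(r, s) \<in> D" using a_max[of r s] k_min[of s] ij rs q(2) by (cases "r = i"; cases "s = j") auto
        qed (use a in auto)
      qed (use a in auto)
    next
      case ah: True
      show ?thesis
      proof (cases "b = k")
        case False
        then have bk: "b < k" using b(2) by simp
        have ib: "(i, b) \<in> D" using k_min[OF b(1) bk] .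
        obtain p where p: "h \<le> p" "p \<le> i" "(p, b) \<notin> D" using b(3) by blast
        then have "p < i" using ib by (metis le_neq_implies_less)
        \<comment> \<open>As \<open>a = h\<close>, the rows strictly between \<open>h\<close> and
          \<open>i\<close> contain only crosses in the rectangle.\<close>
        then have "p = h" using a_max[of p b] p b ah bk by force
        with p have hb: "(h, b) \<notin> D" by simp
        show ?thesis
        proof (rule sub[of i b])
          show "movable D i b" unfolding movable_def using ib hb h by auto
          show "move n D i j = Option.bind (move n D i b) (\<lambda>D'. move n D' i j)"
            using move less.prems False ah by simp
          show "i + (n - b) < i + (n - j)" using b(1) bk k(2) by simp
          show "(forced_step i j)\<^sup>*\<^sup>* D E" if E: "(forced_step i b)\<^sup>*\<^sup>* D E" for E
          proof (rule forced_steps_mono[OF E order_refl _ h(2) bk hb k(3)])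
            fix r s assume rs: "h < r" "r \<le> i" "j \<le> s" "s < b"
            show "(r, s) \<in> D" using b_min[of s r] h_max[of r] ij rs by (cases "s = j"; cases "r = i") auto
          qed (use b in auto)
        qed (use b in auto)
      next
        case True
        note c = corner[OF ah True]
        let ?D = "insert (h, k) (D - {(i, j)})"
        have "move n D i j = Some ?D"
          using move less.prems ah True c ladder_move_eq[OF c] by (auto simp: ladder_movable_def)
        moreover have st: "forced_step i j D ?D"
          using c unfolding forced_step_def
        proof (intro exI conjI allI impI)
          fix r s assume rs: "h < r \<and> r \<le> i \<and> j \<le> s \<and> s < k"
          then show "(r, s) \<in> D" using c unfolding ladder_corner_def by auto
        qed auto
        moreover have "sum fst ?D < sum fst D" using ladder_step_sum_less(2)[OF forced_step_ladder_step[OF st] fin] .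
        ultimately show ?thesis by blast
      qed
    qed
  qed
qed

section \<open>Joins\<close>

lemma prec_Pair: "(a, b) \<prec> (i, j) \<longleftrightarrow> i < a \<or> i = a \<and> b < j"
  unfolding prec_def by auto

lemma prec_trans: "p \<prec> q \<Longrightarrow> q \<prec> r \<Longrightarrow> p \<prec> r"
  unfolding prec_def by auto

lemma prec_total: "p \<prec> q \<or> p = q \<or> q \<prec> p"
  unfolding prec_def by (cases p; cases q) auto

lemma late_steps_antimono:
  assumes "(late_step i j)\<^sup>*\<^sup>* D U" "(a, c) \<prec> (i, j)" shows "(late_step a c)\<^sup>*\<^sup>* D U"
proof -
  have "late_step a c E F" if "late_step i j E F" for E F
    using that prec_trans[OF _ assms(2)] unfolding late_step_def by blast
  then show ?thesis using rtranclp_mono[of "late_step i j" "late_step a c"] assms(1) by blast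
qed

text \<open>The lower left corner of a ladder precedes its upper right corner.\<close>

lemma ladder_steps_first:
  assumes "ladder_step\<^sup>*\<^sup>* D U" "D \<noteq> U"
  shows "\<exists>i j. (i, j) \<in> D \<and> (i, j) \<notin> U \<and> (\<forall>q. q \<prec> (i, j) \<longrightarrow> (q \<in> D \<longleftrightarrow> q \<in> U)) \<and> (late_step i j)\<^sup>*\<^sup>* D U"
  using assms
proof (induction rule: converse_rtranclp_induct)
  case (step D E)
  from step.hyps(1) obtain a c h k where c: "ladder_corner D a c h k" and E: "E = insert (h, k) (D - {(a, c)})"
    unfolding ladder_step_iff by blast
  have hk: "h < a" "c < k" "(a, c) \<in> D" "(h, k) \<notin> D" using c unfolding ladder_corner_def by auto
  have st: "late_step i j D E" if "\<not> (a, c) \<prec> (i, j)" for i j using that c E unfolding late_step_def by blast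
  have same: "q \<in> D \<longleftrightarrow> q \<in> E" if "q \<prec> (a, c)" for q
    using that hk unfolding E by (cases q) (auto simp: prec_Pair)
  have ac: "(a, c) \<notin> E" using hk unfolding E by auto
  have irr: "\<not> (a, c) \<prec> (a, c)" by (simp add: prec_Pair)
  show ?case
  proof (cases "E = U")
    case True
    have "(late_step a c)\<^sup>*\<^sup>* D U" using st[OF irr] True by blast
    then show ?thesis using hk(3) ac same unfolding True by blast
  next
    case False
    then obtain i j where ij: "(i, j) \<in> E" "(i, j) \<notin> U" "\<And>q. q \<prec> (i, j) \<Longrightarrow> q \<in> E \<longleftrightarrow> q \<in> U"
      "(late_step i j)\<^sup>*\<^sup>* E U" using step.IH by blast
    consider "(a, c) \<prec> (i, j)" | "(i, j) = (a, c)" | "(i, j) \<prec> (a, c)" using prec_total by blast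
    then show ?thesis
    proof cases
      case 1
      have "(a, c) \<notin> U" using ac ij(3)[OF 1] by blast
      moreover have "q \<in> D \<longleftrightarrow> q \<in> U" if "q \<prec> (a, c)" for q
        using same[OF that] ij(3)[OF prec_trans[OF that 1]] by blast
      moreover have "(late_step a c)\<^sup>*\<^sup>* D U"
        using converse_rtranclp_into_rtranclp[of "late_step a c", OF st[OF irr] late_steps_antimono[OF ij(4) 1]] .
      ultimately show ?thesis using hk(3) by blast
    next
      case 2
      then show ?thesis using ij(1) ac by simp
    next
      case 3
      have "\<not> (a, c) \<prec> (i, j)" using 3 by (auto simp: prec_Pair)
      then have "(late_step i j)\<^sup>*\<^sup>* D U"
        using converse_rtranclp_into_rtranclp[of "late_step i j", OF st ij(4)] by blast
      moreover have "q \<in> D \<longleftrightarrow> q \<in> U" if "q \<prec> (i, j)" for q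
        using same[OF prec_trans[OF that 3]] ij(3)[OF that] by blast
      moreover have "(i, j) \<in> D" using same[OF 3] ij(1) by blast
      ultimately show ?thesis using ij(2) by blast
    qed
  qed
qed simp

lemma common_predecessor:
  assumes D: "(late_step i j)\<^sup>*\<^sup>* D\<^sub>1 U" "(late_step i j)\<^sup>*\<^sup>* D\<^sub>2 U" "(i, j) \<in> D\<^sub>1" "(i, j) \<in> D\<^sub>2" "(i, j) \<notin> U"
    and i: "0 < i" and dr: "pipe_dream D\<^sub>1" "pipe_dream D\<^sub>2" "pipe_dream U"
  shows "\<exists>U'. ladder_step\<^sup>*\<^sup>* D\<^sub>1 U' \<and> ladder_step\<^sup>*\<^sup>* D\<^sub>2 U' \<and> ladder_step U' U"
proof -
  have e: "grid D\<^sub>1 (int j) (- int i)" "grid D\<^sub>2 (int j) (- int i)" "\<not> grid U (int j) (- int i)"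
    using D(3-5) i by (simp_all add: grid_int)
  obtain x y k h where s: "inverse_ladder (grid U) x y k h"
    and le: "\<And>D'. (avoiding_step (int j) (- int i))\<^sup>*\<^sup>* D' (grid U) \<Longrightarrow> D' (int j) (- int i) \<Longrightarrow> bounded_grid D' \<Longrightarrow>
      (avoiding_step (int j) (- int i))\<^sup>*\<^sup>* D' (relocate (grid U) k h x y)"
    using undo_common[OF late_steps_grid[OF D(1)] e(1,3) grid_bounded[OF dr(1)]] by blast
  have le1: "(avoiding_step (int j) (- int i))\<^sup>*\<^sup>* (grid D\<^sub>1) (relocate (grid U) k h x y)"
    by (rule le[OF late_steps_grid[OF D(1)] e(1) grid_bounded[OF dr(1)]])
  have le2: "(avoiding_step (int j) (- int i))\<^sup>*\<^sup>* (grid D\<^sub>2) (relocate (grid U) k h x y)"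
    by (rule le[OF late_steps_grid[OF D(2)] e(2) grid_bounded[OF dr(2)]])
  obtain U1 where U1: "relocate (grid U) k h x y = grid U1" "pipe_dream U1" "ladder_step\<^sup>*\<^sup>* D\<^sub>1 U1"
    using avoiding_steps_grid[OF le1 dr(1)] by blast
  obtain U2 where U2: "relocate (grid U) k h x y = grid U2" "pipe_dream U2" "ladder_step\<^sup>*\<^sup>* D\<^sub>2 U2"
    using avoiding_steps_grid[OF le2 dr(2)] by blast
  have eq: "U2 = U1" using grid_inj[OF _ U2(2) U1(2)] U1(1) U2(1) by simp
  have l: "ladder (grid U1) x y k h" "relocate (grid U1) x y k h = grid U" using inverse_ladder_relocate[OF s] U1(1) by simp_all
  obtain a c h' k' where c: "x = int c" "y = - int a" "k = int k'" "h = - int h'" "ladder_corner U1 a c h' k'"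
    by (rule grid_ladder_corner[OF l(1) U1(2)])
  have "grid (insert (h', k') (U1 - {(a, c)})) = grid U"
    using l(2) relocate_grid_corner[OF c(5)] unfolding c(1-4) by simp
  then have "insert (h', k') (U1 - {(a, c)}) = U"
    by (rule grid_inj[OF _ ladder_corner_dream[OF c(5) U1(2)] dr(3)])
  then have "ladder_step U1 U" using c(5) ladder_step_iff by blast
  then show ?thesis using U1(3) U2(3) unfolding eq by blast
qed

lemma upper_bound_move:
  assumes D: "D\<^sub>1 \<in> RPD w" "D\<^sub>2 \<in> RPD w" and U: "U \<in> RPD w"
    and le: "ladder_step\<^sup>*\<^sup>* D\<^sub>1 U" "ladder_step\<^sup>*\<^sup>* D\<^sub>2 U"
    and ij: "(i, j) \<in> D\<^sub>1" "(i, j) \<notin> D\<^sub>2" "\<And>q. q \<prec> (i, j) \<Longrightarrow> q \<in> D\<^sub>1 \<longleftrightarrow> q \<in> D\<^sub>2"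
    and E: "(forced_step i j)\<^sup>*\<^sup>* D\<^sub>1 E"
  shows "ladder_step\<^sup>*\<^sup>* E U"
  using U le
proof (induction "sum fst D\<^sub>1 - sum fst U" arbitrary: U rule: less_induct)
  case (less U)
  have dr: "pipe_dream D\<^sub>1" "pipe_dream D\<^sub>2" "pipe_dream U" using D less.prems(1) unfolding RPD_def by auto
  have fin: "finite D\<^sub>1" using dr(1) unfolding pipe_dream_def by simp
  show ?case
  proof (cases "\<forall>q. q \<prec> (i, j) \<longrightarrow> (q \<in> D\<^sub>1 \<longleftrightarrow> q \<in> U)")
    case True
    \<comment> \<open>Otherwise \<open>(i, j)\<close> would be the first disagreement of
      \<open>D\<^sub>2\<close> and \<open>U\<close>, with the cross on the wrong side.\<close>
    have "(i, j) \<notin> U"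
    proof
      assume u: "(i, j) \<in> U"
      then have "D\<^sub>2 \<noteq> U" using ij(2) by blast
      then obtain a c where ac: "(a, c) \<in> D\<^sub>2" "(a, c) \<notin> U" "\<And>q. q \<prec> (a, c) \<Longrightarrow> q \<in> D\<^sub>2 \<longleftrightarrow> q \<in> U"
        using ladder_steps_first[OF less.prems(3)] by blast
      show False using prec_total[of "(a, c)" "(i, j)"] ac ij(2,3) u True by blast
    qed
    then have "D\<^sub>1 \<noteq> U" using ij(1) by blast
    then obtain a c where ac: "(a, c) \<in> D\<^sub>1" "(a, c) \<notin> U" "\<And>q. q \<prec> (a, c) \<Longrightarrow> q \<in> D\<^sub>1 \<longleftrightarrow> q \<in> U"
        "(late_step a c)\<^sup>*\<^sup>* D\<^sub>1 U"
      using ladder_steps_first[OF less.prems(2)] by blast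
    have "(a, c) = (i, j)" using prec_total[of "(a, c)" "(i, j)"] ac(1-3) ij(1) True \<open>(i, j) \<notin> U\<close> by blast
    then have "(late_step i j)\<^sup>*\<^sup>* D\<^sub>1 U" using ac(4) by simp
    moreover have "0 < i" using ij(1) dr(1) unfolding pipe_dream_def by auto
    ultimately show ?thesis using forced_steps_le[OF E _ \<open>(i, j) \<notin> U\<close> _ dr(1,3)] by blast
  next
    case False
    then have "D\<^sub>1 \<noteq> U" by blast
    then obtain a c where ac: "(a, c) \<in> D\<^sub>1" "(a, c) \<notin> U" "\<And>q. q \<prec> (a, c) \<Longrightarrow> q \<in> D\<^sub>1 \<longleftrightarrow> q \<in> U"
        "(late_step a c)\<^sup>*\<^sup>* D\<^sub>1 U"
      using ladder_steps_first[OF less.prems(2)] by blast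
    have lt: "(a, c) \<prec> (i, j)"
    proof (rule ccontr)
      assume "\<not> ?thesis"
      then have "(i, j) = (a, c) \<or> (i, j) \<prec> (a, c)" using prec_total by blast
      then have "\<And>q. q \<prec> (i, j) \<Longrightarrow> q \<prec> (a, c)" using prec_trans by metis
      with ac(3) False show False by blast
    qed
    have ac2: "(a, c) \<in> D\<^sub>2" using ac(1) ij(3)[OF lt] by blast
    then have "D\<^sub>2 \<noteq> U" using ac(2) by blast
    then obtain a' c' where ac': "(a', c') \<in> D\<^sub>2" "(a', c') \<notin> U" "\<And>q. q \<prec> (a', c') \<Longrightarrow> q \<in> D\<^sub>2 \<longleftrightarrow> q \<in> U"
        "(late_step a' c')\<^sup>*\<^sup>* D\<^sub>2 U"
      using ladder_steps_first[OF less.prems(3)] by blast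
    \<comment> \<open>\<open>D\<^sub>1\<close> and \<open>D\<^sub>2\<close> agree up to and
      including \<open>(a, c)\<close>, so both disagree with \<open>U\<close> there for the first
      time, as \<open>common_predecessor\<close> requires.\<close>
    have "(a', c') = (a, c)"
    proof -
      have "\<not> (a, c) \<prec> (a', c')" using ac'(3) ac2 ac(2) by blast
      moreover have "\<not> (a', c') \<prec> (a, c)"
      proof
        assume l: "(a', c') \<prec> (a, c)"
        show False using ac(3)[OF l] ij(3)[OF prec_trans[OF l lt]] ac'(1,2) by blast
      qed
      ultimately show ?thesis using prec_total by blast
    qed
    then have st2: "(late_step a c)\<^sup>*\<^sup>* D\<^sub>2 U" using ac'(4) by simp
    have "0 < a" using ac(1) dr(1) unfolding pipe_dream_def by auto
    then obtain U' where U': "ladder_step\<^sup>*\<^sup>* D\<^sub>1 U'" "ladder_step\<^sup>*\<^sup>* D\<^sub>2 U'" "ladder_step U' U"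
      using common_predecessor[OF ac(4) st2 ac(1) ac2 ac(2) _ dr] by blast
    have R: "U' \<in> RPD w" by (rule ladder_steps_RPD[OF U'(1) D(1)])
    have "finite U'" using R unfolding RPD_def pipe_dream_def by auto
    then have "sum fst U < sum fst U'" using ladder_step_sum_less(2)[OF U'(3)] by blast
    moreover have "sum fst U' \<le> sum fst D\<^sub>1" by (rule ladder_steps_sum_mono[OF U'(1) fin])
    ultimately have "ladder_step\<^sup>*\<^sup>* E U'" using less.hyps[OF _ R U'(1,2)] by linarith
    then show ?thesis using U'(3) by (rule rtranclp.rtrancl_into_rtrancl)
  qed
qed

text \<open>The minimum is taken in the lowest row with a disagreement and there in the leftmost
  column; by the first two assumptions no disagreement lies outside the square.\<close>

lemma principal_disagreement_props:
  assumes D: "D\<^sub>1 \<subseteq> {1..n} \<times> {1..n}" "D\<^sub>2 \<subseteq> {1..n} \<times> {1..n}" and ne: "D\<^sub>1 \<noteq> D\<^sub>2"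
  shows "principal_disagreement n D\<^sub>1 D\<^sub>2 \<in> D\<^sub>1 \<longleftrightarrow> principal_disagreement n D\<^sub>1 D\<^sub>2 \<notin> D\<^sub>2"
    "q \<prec> principal_disagreement n D\<^sub>1 D\<^sub>2 \<Longrightarrow> q \<in> D\<^sub>1 \<longleftrightarrow> q \<in> D\<^sub>2"
proof -
  define X where "X = {p \<in> {1..n} \<times> {1..n}. p \<in> D\<^sub>1 \<longleftrightarrow> p \<notin> D\<^sub>2}"
  have fin: "finite X" unfolding X_def by (rule finite_subset[of _ "{1..n} \<times> {1..n}"]) auto
  have outside: "q \<in> D\<^sub>1 \<longleftrightarrow> q \<in> D\<^sub>2" if "q \<notin> X" for q using that D unfolding X_def by blast
  have Xne: "X \<noteq> {}" using outside ne by blast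
  define i where "i = Max (fst ` X)"
  have i: "i \<in> fst ` X" unfolding i_def using fin Xne by (intro Max_in) auto
  define Y where "Y = {j. (i, j) \<in> X}"
  have Y: "finite Y" "Y \<noteq> {}"
    using i finite_subset[of Y "snd ` X"] fin unfolding Y_def by force+
  define j where "j = Min Y"
  have ij: "(i, j) \<in> X" using Min_in[OF Y] unfolding j_def Y_def by simp
  have min: "q = (i, j) \<or> (i, j) \<prec> q" if "q \<in> X" for q
  proof -
    have "fst q \<le> i" unfolding i_def using that fin by (intro Max_ge) auto
    moreover have "j \<le> snd q" if "fst q = i" 
      unfolding j_def using that \<open>q \<in> X\<close> Y(1) by (intro Min_le) (auto simp: Y_def)
    ultimately show ?thesis by (cases q) (auto simp: prec_Pair le_less)
  qed
  have "principal_disagreement n D\<^sub>1 D\<^sub>2 = (i, j)"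
    unfolding principal_disagreement_def
  proof (rule the_equality)
    show "(i, j) \<in> {1..n} \<times> {1..n} \<and> ((i, j) \<in> D\<^sub>1 \<longleftrightarrow> (i, j) \<notin> D\<^sub>2) \<and>
      (\<forall>q\<in>{1..n} \<times> {1..n}. (q \<in> D\<^sub>1 \<longleftrightarrow> q \<notin> D\<^sub>2) \<longrightarrow> q = (i, j) \<or> (i, j) \<prec> q)"
      using ij min unfolding X_def by blast
    fix p assume "p \<in> {1..n} \<times> {1..n} \<and> (p \<in> D\<^sub>1 \<longleftrightarrow> p \<notin> D\<^sub>2) \<and>
      (\<forall>q\<in>{1..n} \<times> {1..n}. (q \<in> D\<^sub>1 \<longleftrightarrow> q \<notin> D\<^sub>2) \<longrightarrow> q = p \<or> p \<prec> q)"
    then have "p \<in> X" "(i, j) = p \<or> p \<prec> (i, j)" using ij unfolding X_def by blast+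
    with min[of p] show "p = (i, j)" by (cases p) (auto simp: prec_Pair)
  qed
  note pd = this
  show "principal_disagreement n D\<^sub>1 D\<^sub>2 \<in> D\<^sub>1 \<longleftrightarrow> principal_disagreement n D\<^sub>1 D\<^sub>2 \<notin> D\<^sub>2"
    using ij unfolding pd X_def by blast
  show "q \<in> D\<^sub>1 \<longleftrightarrow> q \<in> D\<^sub>2" if "q \<prec> principal_disagreement n D\<^sub>1 D\<^sub>2"
  proof (rule outside, rule notI)
    assume "q \<in> X"
    with min[OF this] that show False unfolding pd by (cases q) (auto simp: prec_Pair)
  qed
qed

lemma RPD_square:
  assumes w: "w permutes {1..n}" and D: "D \<in> RPD w" shows "D \<subseteq> {1..n} \<times> {1..n}"
proof -
  have fin: "finite D" and pos: "D \<subseteq> {1..} \<times> {1..}" using D unfolding RPD_def pipe_dream_def by auto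
  obtain t r where "labelling D t r" using labelling_exists[OF fin] by blast
  then have "i + j \<le> n" if "(i, j) \<in> D" for i j using outer_labels(2)[OF w D _ that] by blast
  then show ?thesis using pos by fastforce
qed

lemma disagreement_move:
  assumes w: "w permutes {1..n}" and D: "D\<^sub>1 \<in> RPD w" "D\<^sub>2 \<in> RPD w"
    and ij: "(i, j) \<in> D\<^sub>1" "(i, j) \<notin> D\<^sub>2" "\<And>q. q \<prec> (i, j) \<Longrightarrow> q \<in> D\<^sub>1 \<longleftrightarrow> q \<in> D\<^sub>2"
  obtains E where "move n D\<^sub>1 i j = Some E" "E \<in> RPD w" "ladder_step\<^sup>*\<^sup>* D\<^sub>1 E" "sum fst E < sum fst D\<^sub>1"
    "\<And>U. U \<in> RPD w \<Longrightarrow> ladder_step\<^sup>*\<^sup>* D\<^sub>1 U \<Longrightarrow> ladder_step\<^sup>*\<^sup>* D\<^sub>2 U \<Longrightarrow> ladder_step\<^sup>*\<^sup>* E U"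
proof -
  have "movable D\<^sub>1 i j"
    by (rule disagreement_movable[OF w D _ _ ij(1,2)]) (use ij(3) in \<open>auto simp: prec_Pair\<close>)
  then obtain E where E: "move n D\<^sub>1 i j = Some E" "(forced_step i j)\<^sup>*\<^sup>* D\<^sub>1 E" "sum fst E < sum fst D\<^sub>1"
    using move_forced_steps[OF w D(1)] by blast
  show thesis
    by (rule that[OF E(1) ladder_steps_RPD[OF forced_steps_ladder_steps[OF E(2)] D(1)] forced_steps_ladder_steps[OF E(2)] E(3)])
      (rule upper_bound_move[OF D _ _ _ ij E(2)])
qed

lemma join_alg_lub:
  assumes w: "w permutes {1..n}" and "D\<^sub>1 \<in> RPD w" "D\<^sub>2 \<in> RPD w"
  shows "\<exists>J. join_alg n D\<^sub>1 D\<^sub>2 = Some J \<and> J \<in> RPD w \<and> ladder_step\<^sup>*\<^sup>* D\<^sub>1 J \<and> ladder_step\<^sup>*\<^sup>* D\<^sub>2 J \<and>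
    (\<forall>U \<in> RPD w. ladder_step\<^sup>*\<^sup>* D\<^sub>1 U \<longrightarrow> ladder_step\<^sup>*\<^sup>* D\<^sub>2 U \<longrightarrow> ladder_step\<^sup>*\<^sup>* J U)"
  using assms(2,3)
proof (induction "sum fst D\<^sub>1 + sum fst D\<^sub>2" arbitrary: D\<^sub>1 D\<^sub>2 rule: less_induct)
  case less
  note D = less.prems
  show ?case
  proof (cases "D\<^sub>1 = D\<^sub>2")
    case True
    then show ?thesis using D by (auto simp: join_alg.simps)
  next
    case False
    obtain i j where ij: "principal_disagreement n D\<^sub>1 D\<^sub>2 = (i, j)" by fastforce
    note pd = principal_disagreement_props[OF RPD_square[OF w D(1)] RPD_square[OF w D(2)] False, unfolded ij]
    note alg = join_alg.simps[of n D\<^sub>1 D\<^sub>2, unfolded ij]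
    show ?thesis
    proof (cases "(i, j) \<in> D\<^sub>1")
      case True
      then have n: "(i, j) \<notin> D\<^sub>2" using pd(1) by blast
      obtain E where E: "move n D\<^sub>1 i j = Some E" "E \<in> RPD w" "ladder_step\<^sup>*\<^sup>* D\<^sub>1 E" "sum fst E < sum fst D\<^sub>1"
        "\<And>U. U \<in> RPD w \<Longrightarrow> ladder_step\<^sup>*\<^sup>* D\<^sub>1 U \<Longrightarrow> ladder_step\<^sup>*\<^sup>* D\<^sub>2 U \<Longrightarrow> ladder_step\<^sup>*\<^sup>* E U"
        using disagreement_move[OF w D True n pd(2)] by blast
      have "sum fst E + sum fst D\<^sub>2 < sum fst D\<^sub>1 + sum fst D\<^sub>2" using E(4) by simp
      from less.hyps[OF this E(2) D(2)] obtain J where J: "join_alg n E D\<^sub>2 = Some J" "J \<in> RPD w"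
        "ladder_step\<^sup>*\<^sup>* E J" "ladder_step\<^sup>*\<^sup>* D\<^sub>2 J"
        "\<forall>U \<in> RPD w. ladder_step\<^sup>*\<^sup>* E U \<longrightarrow> ladder_step\<^sup>*\<^sup>* D\<^sub>2 U \<longrightarrow> ladder_step\<^sup>*\<^sup>* J U" by blast
      have "join_alg n D\<^sub>1 D\<^sub>2 = Some J" using alg False True n E(1) J(1) by simp
      moreover have "ladder_step\<^sup>*\<^sup>* D\<^sub>1 J" using E(3) J(3) by (rule rtranclp_trans)
      ultimately show ?thesis using J(2,4,5) E(5) by blast
    next
      case n: False
      then have t: "(i, j) \<in> D\<^sub>2" using pd(1) by blast
      have eq: "q \<in> D\<^sub>2 \<longleftrightarrow> q \<in> D\<^sub>1" if "q \<prec> (i, j)" for q using pd(2)[OF that] by blast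
      obtain E where E: "move n D\<^sub>2 i j = Some E" "E \<in> RPD w" "ladder_step\<^sup>*\<^sup>* D\<^sub>2 E" "sum fst E < sum fst D\<^sub>2"
        "\<And>U. U \<in> RPD w \<Longrightarrow> ladder_step\<^sup>*\<^sup>* D\<^sub>2 U \<Longrightarrow> ladder_step\<^sup>*\<^sup>* D\<^sub>1 U \<Longrightarrow> ladder_step\<^sup>*\<^sup>* E U"
        using disagreement_move[OF w D(2,1) t n eq] by blast
      have "sum fst D\<^sub>1 + sum fst E < sum fst D\<^sub>1 + sum fst D\<^sub>2" using E(4) by simp
      from less.hyps[OF this D(1) E(2)] obtain J where J: "join_alg n D\<^sub>1 E = Some J" "J \<in> RPD w"
        "ladder_step\<^sup>*\<^sup>* D\<^sub>1 J" "ladder_step\<^sup>*\<^sup>* E J"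
        "\<forall>U \<in> RPD w. ladder_step\<^sup>*\<^sup>* D\<^sub>1 U \<longrightarrow> ladder_step\<^sup>*\<^sup>* E U \<longrightarrow> ladder_step\<^sup>*\<^sup>* J U" by blast
      have "join_alg n D\<^sub>1 D\<^sub>2 = Some J" using alg False n E(1) J(1) by simp
      moreover have "ladder_step\<^sup>*\<^sup>* D\<^sub>2 J" using E(3) J(4) by (rule rtranclp_trans)
      ultimately show ?thesis using J(2,3,5) E(5) by blast
    qed
  qed
qed

theorem theorem4p2:
  fixes n :: nat and w :: "nat \<Rightarrow> nat" and D\<^sub>1 D\<^sub>2 :: pipe_dream
  assumes "w permutes {1..n}"
    and "D\<^sub>1 \<in> RPD w" and "D\<^sub>2 \<in> RPD w"
  shows "\<exists>J. join_alg n D\<^sub>1 D\<^sub>2 = Some J \<and> is_lub (RPD_poset w) J {D\<^sub>1, D\<^sub>2}"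
proof -
  obtain J where J: "join_alg n D\<^sub>1 D\<^sub>2 = Some J" "J \<in> RPD w" "ladder_step\<^sup>*\<^sup>* D\<^sub>1 J" "ladder_step\<^sup>*\<^sup>* D\<^sub>2 J"
    "\<And>U. U \<in> RPD w \<Longrightarrow> ladder_step\<^sup>*\<^sup>* D\<^sub>1 U \<Longrightarrow> ladder_step\<^sup>*\<^sup>* D\<^sub>2 U \<Longrightarrow> ladder_step\<^sup>*\<^sup>* J U"
    using join_alg_lub[OF assms] by blast
  have "Upper (RPD_poset w) {D\<^sub>1, D\<^sub>2} = {U \<in> RPD w. ladder_step\<^sup>*\<^sup>* D\<^sub>1 U \<and> ladder_step\<^sup>*\<^sup>* D\<^sub>2 U}"
    using assms(2,3) unfolding Upper_def RPD_poset_def by auto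
  then have "is_lub (RPD_poset w) J {D\<^sub>1, D\<^sub>2}"
    using J unfolding least_def by (auto simp: RPD_poset_def)
  with J(1) show ?thesis by blast
qed

end
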